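(* Let $X$ be a scattered topological space such that $\mathrm{Homeo}(X)$ is fully transitive, and let $X=\bigsqcup_i X_i$ be the partition of $X$ into similarity classes. Then the universal minimal flow of $\mathrm{Homeo}(X)$ is $\prod_i \mathrm{LO}(X_i)$.
   Context: A topological space (not assumed Hausdorff) is scattered if every nonempty subset has a point isolated in that subset. For scattered $X$, $\mathrm{Homeo}(X)$ carries the topology of pointwise convergence on $X$. Two points $x,y\in X$ are similar if there are neighbourhoods $U_x\ni x$, $U_y\ni y$ and a homeomorphism $h\colon U_x\to U_y$ with $h(x)=y$; the equivalence classes are similarity classes. $\mathrm{Homeo}(X)$ is fully transitive if for every $k$ and all $k$-tuples of pairwise distinct points $(x_1,\dots,x_k)$, $(y_1,\dots,y_k)$ with $x_i$ similar to $y_i$, some homeomorphism $g$ satisfies $g(x_i)=y_i$ for all $i$. For a set $Y$, $\mathrm{LO}(Y)$ is the space of linear orders on $Y$, viewed as a closed subspace of $2^{Y\times Y}$ (product topology), with $\mathrm{Sym}(Y)$ acting by $x\,(g<)\,y \iff g^{-1}x<g^{-1}y$; a homeomorphism of $X$ preserves each $X_i$ and so $\mathrm{Homeo}(X)$ acts on $\prod_i\mathrm{LO}(X_i)$. The universal minimal flow of a topological group is the unique (up to isomorphism) minimal compact continuous $G$-space that maps equivariantly onto every minimal flow. *)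

theory Defs
  imports "HOL-Analysis.Analysis"
begin

definition scattered_space :: "'a topology \<Rightarrow> bool" where
  "scattered_space X \<longleftrightarrow>
     (\<forall>S. S \<subseteq> topspace X \<and> S \<noteq> {} \<longrightarrow>
        (\<exists>x\<in>S. \<exists>U. openin X U \<and> U \<inter> S = {x}))"

text \<open>Homeo(X): homeomorphisms of X onto itself, normalised to be the identity
  outside the carrier (so that they form a group under composition with unit id).\<close>
definition Homeo :: "'a topology \<Rightarrow> ('a \<Rightarrow> 'a) set" where
  "Homeo X = {h. homeomorphic_map X X h \<and> (\<forall>x. x \<notin> topspace X \<longrightarrow> h x = x)}"

definition Homeo_top :: "'a topology \<Rightarrow> ('a \<Rightarrow> 'a) topology" where
  "Homeo_top X =
     subtopology
       (topology_generated_by {{h. h x \<in> U} | x U. x \<in> topspace X \<and> openin X U})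
       (Homeo X)"

definition similar :: "'a topology \<Rightarrow> 'a \<Rightarrow> 'a \<Rightarrow> bool" where
  "similar X x y \<longleftrightarrow>
     (\<exists>U V h. openin X U \<and> openin X V \<and> x \<in> U \<and> y \<in> V \<and>
        homeomorphic_map (subtopology X U) (subtopology X V) h \<and> h x = y)"

definition similarity_classes :: "'a topology \<Rightarrow> 'a set set" where
  "similarity_classes X = {{y \<in> topspace X. similar X x y} | x. x \<in> topspace X}"

definition fully_transitive :: "'a topology \<Rightarrow> bool" where
  "fully_transitive X \<longleftrightarrow>
     (\<forall>xs ys. length xs = length ys \<and> distinct xs \<and> distinct ys \<and>
        set xs \<subseteq> topspace X \<and> set ys \<subseteq> topspace X \<and>
        (\<forall>i<length xs. similar X (xs ! i) (ys ! i)) \<longrightarrow>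
        (\<exists>g\<in>Homeo X. \<forall>i<length xs. g (xs ! i) = ys ! i))"

definition LO :: "'a set \<Rightarrow> ('a \<times> 'a \<Rightarrow> bool) set" where
  "LO Y = {r \<in> (Y \<times> Y) \<rightarrow>\<^sub>E UNIV.
      (\<forall>x\<in>Y. \<not> r (x, x)) \<and>
      (\<forall>x\<in>Y. \<forall>y\<in>Y. \<forall>z\<in>Y. r (x, y) \<and> r (y, z) \<longrightarrow> r (x, z)) \<and>
      (\<forall>x\<in>Y. \<forall>y\<in>Y. x \<noteq> y \<longrightarrow> r (x, y) \<or> r (y, x))}"

definition LO_top :: "'a set \<Rightarrow> ('a \<times> 'a \<Rightarrow> bool) topology" where
  "LO_top Y = subtopology (product_topology (\<lambda>_. discrete_topology UNIV) (Y \<times> Y)) (LO Y)"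

definition prod_LO_top :: "'a topology \<Rightarrow> ('a set \<Rightarrow> ('a \<times> 'a \<Rightarrow> bool)) topology" where
  "prod_LO_top X = product_topology (\<lambda>C. LO_top C) (similarity_classes X)"

definition LO_act :: "'a topology \<Rightarrow> ('a \<Rightarrow> 'a) \<Rightarrow> ('a set \<Rightarrow> ('a \<times> 'a \<Rightarrow> bool))
                        \<Rightarrow> ('a set \<Rightarrow> ('a \<times> 'a \<Rightarrow> bool))" where
  "LO_act X g R =
     (\<lambda>C\<in>similarity_classes X. \<lambda>p\<in>C \<times> C.
        R C (inv_into (topspace X) g (fst p), inv_into (topspace X) g (snd p)))"

definition is_flow :: "('a \<Rightarrow> 'a) topology \<Rightarrow> 'b topology \<Rightarrow> (('a \<Rightarrow> 'a) \<Rightarrow> 'b \<Rightarrow> 'b) \<Rightarrow> bool" where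
  "is_flow TG Y act \<longleftrightarrow>
     topspace Y \<noteq> {} \<and> compact_space Y \<and> Hausdorff_space Y \<and>
     (\<forall>g\<in>topspace TG. \<forall>y\<in>topspace Y. act g y \<in> topspace Y) \<and>
     (\<forall>y\<in>topspace Y. act id y = y) \<and>
     (\<forall>g\<in>topspace TG. \<forall>h\<in>topspace TG. \<forall>y\<in>topspace Y. act (g \<circ> h) y = act g (act h y)) \<and>
     continuous_map (prod_topology TG Y) Y (\<lambda>(g, y). act g y)"

definition is_minimal_flow :: "('a \<Rightarrow> 'a) topology \<Rightarrow> 'b topology \<Rightarrow> (('a \<Rightarrow> 'a) \<Rightarrow> 'b \<Rightarrow> 'b) \<Rightarrow> bool" where
  "is_minimal_flow TG Y act \<longleftrightarrow>
     is_flow TG Y act \<and>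
     (\<forall>Z. closedin Y Z \<and> Z \<noteq> {} \<and> (\<forall>g\<in>topspace TG. \<forall>z\<in>Z. act g z \<in> Z) \<longrightarrow> Z = topspace Y)"

definition flow_maps_onto ::
  "('a \<Rightarrow> 'a) topology \<Rightarrow> 'b topology \<Rightarrow> (('a \<Rightarrow> 'a) \<Rightarrow> 'b \<Rightarrow> 'b)
     \<Rightarrow> 'c topology \<Rightarrow> (('a \<Rightarrow> 'a) \<Rightarrow> 'c \<Rightarrow> 'c) \<Rightarrow> bool" where
  "flow_maps_onto TG M actM Y actY \<longleftrightarrow>
     (\<exists>\<phi>. continuous_map M Y \<phi> \<and> \<phi> ` topspace M = topspace Y \<and>
        (\<forall>g\<in>topspace TG. \<forall>m\<in>topspace M. \<phi> (actM g m) = actY g (\<phi> m)))"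

end

theory Submission
  imports Defs "HOL-Library.Ramsey"
begin

text \<open>
  In a scattered space every similarity class is a discrete subspace, so pointwise convergence makes
  the stabilisers of finite sets of points a neighbourhood base of the identity of Homeo(X), and full
  transitivity says that every finite injection preserving similarity extends to a homeomorphism.
  Minimality of the product of the LO(C) follows at once, because two linear orders on a finite set
  are isomorphic.

  For universality fix any R in the product and a flow Y. Given two closed sets K, L of Y that are
  disjoint, some finite A satisfies v K \<inter> L = {} for all v fixing A pointwise; up to this error,
  whether g y lies in K depends only on the restriction of inv g to A, which is a colouring of the
  injections of A into X. Ramsey's theorem and the compactness of Y yield a point y such that g y and
  h y cannot be separated by such K and L whenever g R and h R agree on A. The closure of
  {(g R, g y)} is therefore the graph of a map, and minimality on both sides makes it an
  equivariant continuous surjection.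
\<close>

subsection \<open>Finite linear orders and Ramsey's theorem\<close>

text \<open>Inverses enter because \<open>LO_act X g R\<close> read on \<open>A\<close> is
  \<open>R\<close> pulled back along \<open>inv g\<close>: class by class, it records the order type
  of the injection \<open>inv g\<close> restricted to \<open>A\<close>. Homeomorphisms whose
  inverses agree on \<open>A\<close> differ by a left factor fixing \<open>A\<close> pointwise,
  which is the error that the separation of \<open>K\<close> and \<open>L\<close> tolerates.
  Replacing a base point \<open>y0\<close> by \<open>act (inv m) y0\<close> composes these
  injections with \<open>m\<close> on the left, so choosing \<open>m\<close> amounts to choosing a
  copy of a finite set inside the classes; Ramsey's theorem supplies a copy on which order-matched
  injections receive equal colours. Two obstacles shape the details. Ramsey's theorem speaks of
  subsets of one infinite set, whereas several classes, some of them finite, occur together here.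
  And the colour is only approximately a function of the restriction, so the conditions on
  \<open>y\<close> are phrased with open sets whose closures are separated; this keeps each
  condition closed in \<open>y\<close>, so that compactness can meet all of them.\<close>

definition strict_linear_on :: "('a \<Rightarrow> 'a \<Rightarrow> bool) \<Rightarrow> 'a set \<Rightarrow> bool" where
  "strict_linear_on r S \<longleftrightarrow> (\<forall>x\<in>S. \<not> r x x) \<and>
     (\<forall>x\<in>S. \<forall>y\<in>S. \<forall>z\<in>S. r x y \<longrightarrow> r y z \<longrightarrow> r x z) \<and>
     (\<forall>x\<in>S. \<forall>y\<in>S. x \<noteq> y \<longrightarrow> r x y \<or> r y x)"

text \<open>The rank identifies a finite linear order with an initial segment of the naturals;
  rigidity, existence of isomorphisms and the passage to Ramsey's theorem all go through it.\<close>

definition order_rank :: "('a \<Rightarrow> 'a \<Rightarrow> bool) \<Rightarrow> 'a set \<Rightarrow> 'a \<Rightarrow> nat" where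
  "order_rank r S x = card {y \<in> S. r y x}"

lemma strict_linear_onD:
  assumes "strict_linear_on r S"
  shows "x \<in> S \<Longrightarrow> \<not> r x x"
    and "x \<in> S \<Longrightarrow> y \<in> S \<Longrightarrow> z \<in> S \<Longrightarrow> r x y \<Longrightarrow> r y z \<Longrightarrow> r x z"
    and "x \<in> S \<Longrightarrow> y \<in> S \<Longrightarrow> x \<noteq> y \<Longrightarrow> r x y \<or> r y x"
proof -
  note * = assms[unfolded strict_linear_on_def]
  show "x \<in> S \<Longrightarrow> \<not> r x x" using * by simp
  show "x \<in> S \<Longrightarrow> y \<in> S \<Longrightarrow> z \<in> S \<Longrightarrow> r x y \<Longrightarrow> r y z \<Longrightarrow> r x z"
    using *[THEN conjunct2, THEN conjunct1, rule_format, of x y z] by simp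
  show "x \<in> S \<Longrightarrow> y \<in> S \<Longrightarrow> x \<noteq> y \<Longrightarrow> r x y \<or> r y x" using * by simp
qed

lemma strict_linear_on_subset:
  assumes "strict_linear_on r S" "T \<subseteq> S"
  shows "strict_linear_on r T"
  unfolding strict_linear_on_def
proof (intro conjI ballI impI)
  fix x y z assume "x \<in> T" "y \<in> T" "z \<in> T" "r x y" "r y z"
  then show "r x z" using strict_linear_onD(2)[OF assms(1), of x y z] assms(2) by auto
qed (use strict_linear_onD(1,3)[OF assms(1)] assms(2) in auto)

lemma order_rank_less:
  assumes "finite S" "strict_linear_on r S" "x \<in> S" "y \<in> S" "r x y"
  shows "order_rank r S x < order_rank r S y"
  unfolding order_rank_def
proof (rule psubset_card_mono)
  have "{z \<in> S. r z x} \<subseteq> {z \<in> S. r z y}"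
    using strict_linear_onD(2)[OF assms(2) _ assms(3,4) _ assms(5)] by blast
  moreover have "x \<in> {z \<in> S. r z y}" "x \<notin> {z \<in> S. r z x}"
    using strict_linear_onD(1)[OF assms(2)] assms(3,5) by auto
  ultimately show "{z \<in> S. r z x} \<subset> {z \<in> S. r z y}" by auto
qed (use assms(1) in simp)

lemma order_rank_less_iff:
  assumes "finite S" "strict_linear_on r S" "x \<in> S" "y \<in> S"
  shows "order_rank r S x < order_rank r S y \<longleftrightarrow> r x y"
proof
  assume less: "order_rank r S x < order_rank r S y"
  then have "x \<noteq> y" by auto
  moreover have "\<not> r y x" using order_rank_less[OF assms(1,2,4,3)] less by auto
  ultimately show "r x y" using strict_linear_onD(3)[OF assms(2-4)] by blast
qed (rule order_rank_less[OF assms])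

lemma inj_on_order_rank:
  assumes "finite S" "strict_linear_on r S"
  shows "inj_on (order_rank r S) S"
proof (rule inj_onI, rule ccontr)
  fix x y assume xy: "x \<in> S" "y \<in> S" "order_rank r S x = order_rank r S y" "x \<noteq> y"
  then have "r x y \<or> r y x" using strict_linear_onD(3)[OF assms(2)] by blast
  then show False using order_rank_less[OF assms, of x y] order_rank_less[OF assms, of y x] xy by auto
qed

lemma order_rank_image:
  assumes "finite S" "strict_linear_on r S"
  shows "order_rank r S ` S = {..<card S}"
proof (rule card_subset_eq)
  have "order_rank r S x < card S" if "x \<in> S" for x
  proof -
    have "x \<notin> {y \<in> S. r y x}" using strict_linear_onD(1)[OF assms(2)] by auto
    with that have "{y \<in> S. r y x} \<subset> S" by auto
    then show ?thesis unfolding order_rank_def by (rule psubset_card_mono[OF assms(1)])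
  qed
  then show "order_rank r S ` S \<subseteq> {..<card S}" by blast
  show "card (order_rank r S ` S) = card {..<card S}"
    using card_image[OF inj_on_order_rank[OF assms]] by simp
qed simp

lemma order_rank_transfer:
  assumes "inj_on u A" "x \<in> A" "\<And>s t. s \<in> A \<Longrightarrow> t \<in> A \<Longrightarrow> r (u s) (u t) \<longleftrightarrow> q s t"
  shows "order_rank r (u ` A) (u x) = order_rank q A x"
proof -
  have "{y \<in> u ` A. r y (u x)} = u ` {s \<in> A. q s x}" using assms(2,3) by auto
  moreover have "inj_on u {s \<in> A. q s x}" using assms(1) by (rule inj_on_subset) auto
  ultimately show ?thesis unfolding order_rank_def by (simp add: card_image)
qed

text \<open>Finite linear orders are rigid: \<open>u x\<close> and \<open>v x\<close> both have in
  the common image the rank that \<open>x\<close> has in the order pulled back to \<open>A\<close>.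
  This makes a Ramsey colouring of sets well defined and settles the finite similarity
  classes.\<close>

lemma finite_order_embedding_unique:
  assumes "finite A" "strict_linear_on r (u ` A)" "u ` A = v ` A" "inj_on u A" "inj_on v A"
    and "\<And>s t. s \<in> A \<Longrightarrow> t \<in> A \<Longrightarrow> r (u s) (u t) \<longleftrightarrow> r (v s) (v t)"
    and "x \<in> A"
  shows "u x = v x"
proof -
  define q where "q = (\<lambda>s t. r (v s) (v t))"
  have "order_rank r (u ` A) (u x) = order_rank q A x"
    by (rule order_rank_transfer) (use assms in \<open>auto simp: q_def\<close>)
  moreover have "order_rank r (u ` A) (v x) = order_rank q A x"
    unfolding assms(3) by (rule order_rank_transfer) (use assms in \<open>auto simp: q_def\<close>)
  moreover have "u x \<in> u ` A" "v x \<in> u ` A" using assms(3,7) by auto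
  moreover have "inj_on (order_rank r (u ` A)) (u ` A)"
    by (rule inj_on_order_rank) (use assms(1,2) in auto)
  ultimately show ?thesis by (metis inj_onD)
qed

text \<open>Both ranks are bijections onto \<open>{..<card A}\<close>; \<open>u\<close> is one
  followed by the inverse of the other.\<close>

lemma finite_order_iso_exists:
  assumes "finite A" "strict_linear_on r A" "strict_linear_on q A"
  obtains u where "bij_betw u A A" "\<And>x y. x \<in> A \<Longrightarrow> y \<in> A \<Longrightarrow> r (u x) (u y) \<longleftrightarrow> q x y"
proof
  define u where "u = inv_into A (order_rank r A) \<circ> order_rank q A"
  have q: "bij_betw (order_rank q A) A {..<card A}" and r: "bij_betw (order_rank r A) A {..<card A}"
    unfolding bij_betw_def using inj_on_order_rank order_rank_image assms by blast+
  show u: "bij_betw u A A"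
    unfolding u_def using q bij_betw_inv_into[OF r] by (rule bij_betw_trans)
  fix x y assume xy: "x \<in> A" "y \<in> A"
  have "order_rank r A (u z) = order_rank q A z" if "z \<in> A" for z
    unfolding u_def comp_def
    by (rule f_inv_into_f) (use q r that in \<open>auto simp: bij_betw_def\<close>)
  moreover have "u x \<in> A" "u y \<in> A" using u xy by (auto simp: bij_betw_def)
  ultimately show "r (u x) (u y) \<longleftrightarrow> q x y"
    using order_rank_less_iff[OF assms(1,2), of "u x" "u y"] order_rank_less_iff[OF assms(1,3), of x y] xy
    by simp
qed

text \<open>An embedding of \<open>A\<close> into the naturals is determined by its order type and
  its image. For the order type shared by \<open>p\<close> and \<open>q\<close>, a colouring of
  embeddings is therefore a colouring of sets of size \<open>card A\<close>.\<close>

lemma Ramsey_order_type: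
  fixes p q :: "'a \<Rightarrow> nat" and col :: "('a \<Rightarrow> nat) \<Rightarrow> bool"
  assumes H: "infinite (H :: nat set)" and A: "finite A"
    and inj: "inj_on p A" "inj_on q A"
    and pq: "\<And>s t. s \<in> A \<Longrightarrow> t \<in> A \<Longrightarrow> p s < p t \<longleftrightarrow> q s < q t"
    and col: "\<And>u v. (\<And>t. t \<in> A \<Longrightarrow> u t = v t) \<Longrightarrow> (col u \<longleftrightarrow> col v)"
  obtains H' where "H' \<subseteq> H" "infinite H'"
    "\<And>h. strict_mono h \<Longrightarrow> range h \<subseteq> H' \<Longrightarrow> (col (h \<circ> p) \<longleftrightarrow> col (h \<circ> q))"
proof -
  \<comment> \<open>\<open>compat S u\<close> says that \<open>u\<close> is the embedding with image
    \<open>S\<close> of the order type of \<open>p\<close>, hence also of that of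
    \<open>q\<close>.\<close>
  define compat where "compat = (\<lambda>S (u :: 'a \<Rightarrow> nat). u ` A = S \<and> (\<forall>s\<in>A. \<forall>t\<in>A. u s < u t \<longleftrightarrow> p s < p t))"
  define f :: "nat set \<Rightarrow> nat" where "f = (\<lambda>S. if \<exists>u. compat S u \<and> col u then 1 else 0)"
  have "\<forall>S. S \<subseteq> H \<and> finite S \<and> card S = card A \<longrightarrow> f S < 2" by (simp add: f_def)
  from Ramsey[of H "card A" f 2, OF H this] obtain H' t where H': "H' \<subseteq> H" "infinite H'"
    and t: "\<forall>S. S \<subseteq> H' \<and> finite S \<and> card S = card A \<longrightarrow> f S = t"
    by (elim exE conjE) (rule that)
  have hom: "f S = t" if "S \<subseteq> H'" "finite S" "card S = card A" for S
    using t that by simp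
  have inj_compat: "inj_on u A" if "compat S u" for S u
  proof (rule inj_onI)
    fix x y assume "x \<in> A" "y \<in> A" "u x = u y"
    then have "p x = p y" using that unfolding compat_def by (metis less_irrefl nat_neq_iff)
    then show "x = y" using inj(1) \<open>x \<in> A\<close> \<open>y \<in> A\<close> by (auto dest: inj_onD)
  qed
  \<comment> \<open>By rigidity the existential in \<open>f\<close> ranges over a single embedding,
    up to values outside \<open>A\<close>, which \<open>col\<close> ignores.\<close>
  have f_eq: "f S = 1 \<longleftrightarrow> col u" if u: "compat S u" for S u
  proof -
    have "col v \<longleftrightarrow> col u" if v: "compat S v" for v
    proof (rule col)
      fix t assume "t \<in> A"
      show "v t = u t"
      proof (rule finite_order_embedding_unique[of A "(<)"])
        show "strict_linear_on (<) (v ` A)" by (auto simp: strict_linear_on_def)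
        show "v ` A = u ` A" using u v by (simp add: compat_def)
        show "v s < v t \<longleftrightarrow> u s < u t" if "s \<in> A" "t \<in> A" for s t
          using u v that by (simp add: compat_def)
      qed (use A u v \<open>t \<in> A\<close> inj_compat in blast)+
    qed
    then have "(\<exists>v. compat S v \<and> col v) \<longleftrightarrow> col u" using u by meson
    then show ?thesis by (simp add: f_def)
  qed
  show ?thesis
  proof (rule that[OF H'])
    fix h assume h: "strict_mono (h :: nat \<Rightarrow> nat)" "range h \<subseteq> H'"
    have inj_h: "inj_on h B" for B
      by (rule inj_on_subset[OF strict_mono_imp_inj_on[OF h(1)] subset_UNIV])
    have "f (h ` p ` A) = t"
      using h(2) by (intro hom) (auto simp: card_image inj_h inj A)
    moreover have "f (h ` q ` A) = t"
      using h(2) by (intro hom) (auto simp: card_image inj_h inj A)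
    moreover have "compat (h ` p ` A) (h \<circ> p)"
      by (simp add: compat_def image_comp strict_mono_less[OF h(1)])
    moreover have "compat (h ` q ` A) (h \<circ> q)"
      by (simp add: compat_def image_comp strict_mono_less[OF h(1)] pq)
    ultimately show "col (h \<circ> p) \<longleftrightarrow> col (h \<circ> q)"
      using f_eq[of "h ` p ` A" "h \<circ> p"] f_eq[of "h ` q ` A" "h \<circ> q"] by simp
  qed
qed

text \<open>The infinite set is thinned out once for each index; what was achieved for earlier
  indices survives because it passes to subsets.\<close>

lemma Ramsey_order_type_finite_family:
  fixes p q :: "'i \<Rightarrow> 'a \<Rightarrow> nat" and col :: "'i \<Rightarrow> ('a \<Rightarrow> nat) \<Rightarrow> bool"
  assumes "finite I" and A: "\<And>i. i \<in> I \<Longrightarrow> finite (A i)"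
    and inj: "\<And>i. i \<in> I \<Longrightarrow> inj_on (p i) (A i)" "\<And>i. i \<in> I \<Longrightarrow> inj_on (q i) (A i)"
    and pq: "\<And>i s t. i \<in> I \<Longrightarrow> s \<in> A i \<Longrightarrow> t \<in> A i \<Longrightarrow> p i s < p i t \<longleftrightarrow> q i s < q i t"
    and col: "\<And>i u v. i \<in> I \<Longrightarrow> (\<And>t. t \<in> A i \<Longrightarrow> u t = v t) \<Longrightarrow> (col i u \<longleftrightarrow> col i v)"
  obtains h :: "nat \<Rightarrow> nat" where "strict_mono h"
    "\<And>i. i \<in> I \<Longrightarrow> (col i (h \<circ> p i) \<longleftrightarrow> col i (h \<circ> q i))"
proof -
  \<comment> \<open>Quantifying over every \<open>h\<close> with range in \<open>H\<close> is what
    makes \<open>good i\<close> hereditary; the increasing enumeration of the final set is the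
    \<open>h\<close> returned.\<close>
  define good where "good = (\<lambda>i H. \<forall>h :: nat \<Rightarrow> nat. strict_mono h \<longrightarrow> range h \<subseteq> H \<longrightarrow>
    col i (h \<circ> p i) = col i (h \<circ> q i))"
  have "\<exists>H :: nat set. infinite H \<and> (\<forall>i\<in>J. good i H)" if "J \<subseteq> I" for J
    using finite_subset[OF that \<open>finite I\<close>] that
  proof (induction J)
    case empty
    then show ?case using infinite_UNIV_nat by blast
  next
    case (insert i J)
    then obtain H :: "nat set" where H: "infinite H" "\<And>j. j \<in> J \<Longrightarrow> good j H" by auto
    have i: "i \<in> I" using insert.prems by auto
    obtain H' where H': "H' \<subseteq> H" "infinite H'"
      "\<And>h. strict_mono h \<Longrightarrow> range h \<subseteq> H' \<Longrightarrow> (col i (h \<circ> p i) \<longleftrightarrow> col i (h \<circ> q i))"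
      using Ramsey_order_type[OF H(1) A[OF i] inj(1)[OF i] inj(2)[OF i] pq[OF i], of "col i"] col[OF i]
      by metis
    have "good i H'" using H'(3) by (simp add: good_def)
    moreover have "good j H'" if "j \<in> J" for j
      using H(2)[OF that] H'(1) unfolding good_def by (meson order_trans)
    ultimately show ?case using H'(2) by auto
  qed
  then obtain H :: "nat set" where H: "infinite H" "\<And>i. i \<in> I \<Longrightarrow> good i H" by blast
  show ?thesis
  proof (rule that)
    show "strict_mono (enumerate H)" using H(1) by (rule strict_mono_enumerate)
    show "col i (enumerate H \<circ> p i) \<longleftrightarrow> col i (enumerate H \<circ> q i)" if "i \<in> I" for i
      using H(2)[OF that] strict_mono_enumerate[OF H(1)] range_enumerate[OF H(1)]
      unfolding good_def by simp
  qed
qed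

subsection \<open>Similarity classes and the topology of Homeo(X)\<close>

definition sim_class :: "'a topology \<Rightarrow> 'a \<Rightarrow> 'a set" where
  "sim_class X x = {y \<in> topspace X. similar X x y}"

text \<open>A witness of similarity may be cut down to any open part of its domain. This lets two
  witnesses share a domain, and lets one witness relate all the points of its domain to their
  images.\<close>

lemma homeomorphic_map_restrict_open:
  assumes h: "homeomorphic_map (subtopology X U) (subtopology X V) h"
    and "openin X U" "openin X V" "openin X W" "W \<subseteq> U"
  shows "openin X (h ` W)" "h ` W \<subseteq> V"
    "homeomorphic_map (subtopology X W) (subtopology X (h ` W)) h"
proof -
  have U: "topspace (subtopology X U) = U" "topspace (subtopology X V) = V"
    using assms openin_subset by fastforce+
  have "openin (subtopology X U) W"
    using assms by (simp add: openin_open_subtopology)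
  then have "openin (subtopology X V) (h ` W)"
    using homeomorphic_imp_open_map[OF h] unfolding open_map_def by blast
  then show *: "openin X (h ` W)" "h ` W \<subseteq> V"
    using assms by (simp_all add: openin_open_subtopology)
  have "homeomorphic_map (subtopology (subtopology X U) W) (subtopology (subtopology X V) (h ` W)) h"
    by (rule homeomorphic_map_subtopologies[OF h])
      (use * \<open>W \<subseteq> U\<close> in \<open>simp add: U Int_absorb1 del: topspace_subtopology\<close>)
  then show "homeomorphic_map (subtopology X W) (subtopology X (h ` W)) h"
    using * \<open>W \<subseteq> U\<close> by (simp add: subtopology_subtopology Int_absorb1)
qed

section \<open>Similarity as an equivalence relation\<close>

lemma similarI:
  assumes "openin X U" "openin X V" "x \<in> U" "h x \<in> V"
    "homeomorphic_map (subtopology X U) (subtopology X V) h" "h x = y"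
  shows "similar X x y"
  unfolding similar_def using assms by (intro exI[of _ U] exI[of _ V] exI[of _ h]) simp

lemma similar_imp_topspace: "similar X x y \<Longrightarrow> x \<in> topspace X \<and> y \<in> topspace X"
  by (auto simp: similar_def dest: openin_subset)

lemma similar_refl: "x \<in> topspace X \<Longrightarrow> similar X x x"
  by (rule similarI[of X "topspace X" "topspace X" x id]) auto

lemma similar_sym:
  assumes "similar X x y"
  shows "similar X y x"
proof -
  obtain U V h where U: "openin X U" "openin X V" "x \<in> U" "y \<in> V"
    and h: "homeomorphic_map (subtopology X U) (subtopology X V) h" "h x = y"
    using assms unfolding similar_def by blast
  obtain k where "homeomorphic_maps (subtopology X U) (subtopology X V) h k"
    using h(1) homeomorphic_map_maps by blast
  then have "homeomorphic_map (subtopology X V) (subtopology X U) k" "k y = x"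
    using U h(2) openin_subset[OF U(1)] by (auto simp: homeomorphic_maps_map)
  with U show ?thesis by (intro similarI[of X V U y k x]) simp_all
qed

lemma similar_trans:
  assumes "similar X x y" "similar X y z"
  shows "similar X x z"
proof -
  \<comment> \<open>Both witnesses are made to start at \<open>y\<close>, so that they can be
    restricted to the same neighbourhood \<open>W\<close>.\<close>
  obtain V U h where U: "openin X U" "openin X V" "x \<in> U" "y \<in> V"
    and h: "homeomorphic_map (subtopology X V) (subtopology X U) h" "h y = x"
    using similar_sym[OF assms(1)] unfolding similar_def by blast
  obtain V' U' h' where U': "openin X U'" "openin X V'" "z \<in> U'" "y \<in> V'"
    and h': "homeomorphic_map (subtopology X V') (subtopology X U') h'" "h' y = z"
    using assms(2) unfolding similar_def by blast
  define W where "W = V \<inter> V'"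
  have W: "openin X W" "W \<subseteq> V" "W \<subseteq> V'" "y \<in> W" using U U' by (auto simp: W_def)
  note r = homeomorphic_map_restrict_open[OF h(1) U(2,1) W(1,2)]
  note r' = homeomorphic_map_restrict_open[OF h'(1) U'(2,1) W(1,3)]
  obtain k where k: "homeomorphic_maps (subtopology X W) (subtopology X (h ` W)) h k"
    using r(3) homeomorphic_map_maps by blast
  then have k': "homeomorphic_map (subtopology X (h ` W)) (subtopology X W) k" "k x = y"
    using W h(2) openin_subset[OF W(1)] by (auto simp: homeomorphic_maps_map)
  have "homeomorphic_map (subtopology X (h ` W)) (subtopology X (h' ` W)) (h' \<circ> k)"
    using homeomorphic_map_compose[OF k'(1) r'(3)] .
  moreover have "(h' \<circ> k) x = z" using k'(2) h'(2) by simp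
  moreover have "x \<in> h ` W" "z \<in> h' ` W" using h(2) h'(2) W(4) by blast+
  ultimately show ?thesis using r(1) r'(1) by (intro similarI[of X "h ` W" "h' ` W" x "h' \<circ> k"]) simp_all
qed

lemma sim_class_self: "x \<in> topspace X \<Longrightarrow> x \<in> sim_class X x"
  by (simp add: sim_class_def similar_refl)

lemma sim_class_subset: "sim_class X x \<subseteq> topspace X"
  by (auto simp: sim_class_def)

lemma sim_class_eq_iff:
  assumes "x \<in> topspace X" "y \<in> topspace X"
  shows "sim_class X x = sim_class X y \<longleftrightarrow> similar X x y"
proof
  assume "sim_class X x = sim_class X y"
  then have "y \<in> sim_class X x" using sim_class_self[OF assms(2)] by simp
  then show "similar X x y" by (simp add: sim_class_def)
next
  assume "similar X x y"
  then have "similar X x z \<longleftrightarrow> similar X y z" for z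
    by (metis similar_sym similar_trans)
  then show "sim_class X x = sim_class X y" by (simp add: sim_class_def)
qed

lemma sim_class_eq: "y \<in> sim_class X x \<Longrightarrow> sim_class X y = sim_class X x"
  using sim_class_eq_iff[of x X y] similar_imp_topspace[of X x y] by (simp add: sim_class_def)

lemma similarity_classes_eq: "similarity_classes X = sim_class X ` topspace X"
  by (auto simp: similarity_classes_def sim_class_def)

section \<open>The group of homeomorphisms\<close>

lemma Homeo_id: "id \<in> Homeo X"
  by (simp add: Homeo_def)

lemma Homeo_in_topspace_iff:
  assumes "g \<in> Homeo X"
  shows "g x \<in> topspace X \<longleftrightarrow> x \<in> topspace X"
proof -
  have "g ` topspace X = topspace X" "\<And>x. x \<notin> topspace X \<Longrightarrow> g x = x"
    using assms homeomorphic_imp_surjective_map[of X X g] by (simp_all add: Homeo_def)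
  then show ?thesis by (metis imageI)
qed

text \<open>Being the identity off the carrier turns a homeomorphism into a permutation of the whole
  type, so the global \<open>inv\<close> is its group inverse.\<close>

lemma bij_Homeo:
  assumes "g \<in> Homeo X"
  shows "bij g"
proof -
  have g: "g ` topspace X = topspace X" "\<And>x. x \<notin> topspace X \<Longrightarrow> g x = x" "inj_on g (topspace X)"
    using assms homeomorphic_imp_surjective_map[of X X g] homeomorphic_imp_injective_map[of X X g]
    by (simp_all add: Homeo_def)
  have "inj g"
  proof (rule injI)
    fix x y assume "g x = g y"
    then show "x = y"
      using g(2)[of x] g(2)[of y] inj_onD[OF g(3)] Homeo_in_topspace_iff[OF assms, of x]
        Homeo_in_topspace_iff[OF assms, of y] by metis
  qed
  moreover have "y \<in> range g" for y
  proof (cases "y \<in> topspace X")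
    case True
    then show ?thesis using g(1) by auto
  next
    case False
    then show ?thesis using g(2)[of y] by (metis rangeI)
  qed
  ultimately show ?thesis by (auto simp: bij_def)
qed

lemma Homeo_comp:
  assumes "g \<in> Homeo X" "h \<in> Homeo X"
  shows "g \<circ> h \<in> Homeo X"
  using assms homeomorphic_map_compose[of X X h X g] by (simp add: Homeo_def)

lemma inv_into_Homeo:
  assumes "g \<in> Homeo X" "x \<in> topspace X"
  shows "inv_into (topspace X) g x = inv g x"
proof -
  have "g (inv g x) = x" using bij_Homeo[OF assms(1)] by (simp add: bij_is_surj surj_f_inv_f)
  then show ?thesis
    using Homeo_in_topspace_iff[OF assms(1), of "inv g x"] assms(2)
    by (intro inv_into_f_eq) (auto intro: inj_on_subset[OF bij_is_inj[OF bij_Homeo[OF assms(1)]]])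
qed

lemma Homeo_inv:
  assumes "g \<in> Homeo X"
  shows "inv g \<in> Homeo X"
proof -
  have b: "bij g" by (rule bij_Homeo[OF assms])
  obtain k where k: "homeomorphic_maps X X g k"
    using assms unfolding Homeo_def homeomorphic_map_maps by blast
  have "k x = inv g x" if "x \<in> topspace X" for x
  proof -
    have "g (k x) = x" using k that by (auto simp: homeomorphic_maps_map)
    then show ?thesis using bij_is_inj[OF b] by (metis inv_f_f)
  qed
  moreover have "homeomorphic_map X X k" using k by (simp add: homeomorphic_maps_map)
  ultimately have "homeomorphic_map X X (inv g)" using homeomorphic_map_eq by blast
  moreover have "inv g x = x" if "x \<notin> topspace X" for x
  proof -
    have "g x = x" using assms that by (simp add: Homeo_def)
    then show ?thesis using bij_is_inj[OF b] by (metis inv_f_f)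
  qed
  ultimately show ?thesis by (simp add: Homeo_def)
qed

lemma Homeo_similar:
  assumes "g \<in> Homeo X" "x \<in> topspace X"
  shows "similar X x (g x)"
proof (rule similarI)
  show "homeomorphic_map (subtopology X (topspace X)) (subtopology X (topspace X)) g"
    using assms(1) by (simp add: Homeo_def)
qed (use assms Homeo_in_topspace_iff[OF assms(1)] in simp_all)

lemma Homeo_sim_class:
  assumes "g \<in> Homeo X" "x \<in> sim_class X z"
  shows "g x \<in> sim_class X z"
  using assms(2) similar_trans[of X z x "g x"] Homeo_similar[OF assms(1), of x]
    Homeo_in_topspace_iff[OF assms(1), of x]
  by (simp add: sim_class_def)

text \<open>Scatteredness isolates a single point \<open>y\<close> of the class. A local
  homeomorphism from \<open>y\<close> to \<open>x\<close> preserves similarity classes pointwise, so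
  it carries the isolation over to \<open>x\<close>.\<close>

lemma scattered_sim_class_discrete:
  assumes "scattered_space X" "x \<in> topspace X"
  obtains U where "openin X U" "U \<inter> sim_class X x = {x}"
proof -
  have "sim_class X x \<subseteq> topspace X \<and> sim_class X x \<noteq> {}"
    using sim_class_self[OF assms(2)] sim_class_subset[of X x] by auto
  with assms(1)[unfolded scattered_space_def, THEN spec[of _ "sim_class X x"]]
  have "\<exists>y\<in>sim_class X x. \<exists>U. openin X U \<and> U \<inter> sim_class X x = {y}"
    by (rule mp)
  then obtain y U where y: "y \<in> sim_class X x" "openin X U" "U \<inter> sim_class X x = {y}"
    by blast
  have "similar X y x" using y(1) by (simp add: sim_class_def similar_sym)
  then obtain V W h where V: "openin X V" "openin X W" "y \<in> V" "x \<in> W"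
    and h: "homeomorphic_map (subtopology X V) (subtopology X W) h" "h y = x"
    unfolding similar_def by blast
  have UV: "openin X (U \<inter> V)" "U \<inter> V \<subseteq> V" using y V by auto
  note r = homeomorphic_map_restrict_open[OF h(1) V(1,2) UV]
  show thesis
  proof (rule that[OF r(1)])
    \<comment> \<open>The restricted \<open>h\<close> itself witnesses that \<open>z\<close> is
      similar to \<open>h z\<close>; hence \<open>z\<close> lies in the class and in
      \<open>U\<close>, where \<open>y\<close> is the only such point.\<close>
    have "z = y" if z: "z \<in> U \<inter> V" "h z \<in> sim_class X x" for z
    proof -
      have "similar X z (h z)"
        by (rule similarI[OF UV(1) r(1) z(1) _ r(3)]) (use z(1) in auto)
      then have "z \<in> sim_class X x"
        using z(2) similar_trans[of X x "h z" z] similar_sym[of X z "h z"] similar_imp_topspace[of X z "h z"]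
        by (simp add: sim_class_def)
      then show ?thesis using z(1) y(3) by blast
    qed
    then show "h ` (U \<inter> V) \<inter> sim_class X x = {x}"
      using h(2) V(3) y sim_class_self[OF assms(2)] by auto
  qed
qed

text \<open>A generated topology lives on the union of its generators, and any point of
  \<open>X\<close> yields a generator containing all of \<open>Homeo X\<close>.\<close>

lemma topspace_Homeo_top:
  assumes "topspace X \<noteq> {}"
  shows "topspace (Homeo_top X) = Homeo X"
proof -
  obtain x where x: "x \<in> topspace X" using assms by blast
  have "Homeo X \<subseteq> {h. h x \<in> topspace X}" using x by (auto simp: Homeo_in_topspace_iff)
  then have "Homeo X \<subseteq> \<Union> {{h. h x \<in> U} |x U. x \<in> topspace X \<and> openin X U}"
    using x openin_topspace by blast
  then show ?thesis by (simp add: Homeo_top_def Int_absorb1)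
qed

text \<open>A homeomorphism moves \<open>x\<close> only within its class, where \<open>y\<close> is
  isolated by some open \<open>U\<close>; there \<open>h x = y\<close> amounts to
  \<open>h x \<in> U\<close>. For \<open>y\<close> outside the class the set is empty.\<close>

lemma openin_Homeo_top_eval:
  assumes "scattered_space X" "x \<in> topspace X"
  shows "openin (Homeo_top X) {h \<in> Homeo X. h x = y}"
proof (cases "y \<in> sim_class X x")
  case True
  then have "y \<in> topspace X" by (simp add: sim_class_def)
  then obtain U where U: "openin X U" "U \<inter> sim_class X x = {y}"
    using scattered_sim_class_discrete[OF assms(1), of y] sim_class_eq[OF True] by metis
  have "{h \<in> Homeo X. h x = y} = {h. h x \<in> U} \<inter> Homeo X"
    using U Homeo_sim_class[OF _ sim_class_self[OF assms(2)]] by auto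
  moreover have "openin (topology_generated_by {{h. h x \<in> U} |x U. x \<in> topspace X \<and> openin X U}) {h. h x \<in> U}"
    unfolding openin_topology_generated_by_iff
    by (rule generate_topology_on.Basis) (use assms(2) U(1) in blast)
  ultimately show ?thesis unfolding Homeo_top_def openin_subtopology by blast
next
  case False
  then have "{h \<in> Homeo X. h x = y} = {}"
    using Homeo_sim_class[OF _ sim_class_self[OF assms(2)]] by auto
  then show ?thesis using openin_empty by metis
qed

lemma Homeo_top_nhd_stabilizer:
  assumes "openin (Homeo_top X) N" "g \<in> N"
  obtains A where "finite A" "A \<subseteq> topspace X"
    "\<And>h. h \<in> Homeo X \<Longrightarrow> (\<And>a. a \<in> A \<Longrightarrow> h a = g a) \<Longrightarrow> h \<in> N"
proof -
  obtain W where W: "generate_topology_on {{h. h x \<in> U} |x U. x \<in> topspace X \<and> openin X U} W"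
    and N: "N = W \<inter> Homeo X"
    using assms(1) unfolding Homeo_top_def openin_subtopology openin_topology_generated_by_iff by blast
  \<comment> \<open>Here \<open>h\<close> ranges over all functions, because the generated topology
    does; the restriction to \<open>Homeo X\<close> comes at the end.\<close>
  define nhd where "nhd = (\<lambda>V (g :: 'a \<Rightarrow> 'a) A. finite A \<and> A \<subseteq> topspace X \<and> (\<forall>h. (\<forall>a\<in>A. h a = g a) \<longrightarrow> h \<in> V))"
  from W have "\<exists>A. nhd W g A" if "g \<in> W" for g
    using that
  proof (induction arbitrary: g)
    case Empty
    then show ?case by simp
  next
    case (Int a b)
    obtain A where "nhd a g A" using Int.IH(1)[of g] Int.prems by auto
    moreover obtain B where "nhd b g B" using Int.IH(2)[of g] Int.prems by auto
    ultimately have "nhd (a \<inter> b) g (A \<union> B)" by (simp add: nhd_def)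
    then show ?case ..
  next
    case (UN K)
    then obtain k where k: "k \<in> K" "g \<in> k" by auto
    then obtain A where "nhd k g A" using UN.IH[of k g] by auto
    then have "nhd (\<Union>K) g A" using k(1) by (auto simp: nhd_def)
    then show ?case ..
  next
    case (Basis s)
    then obtain x U where "s = {h. h x \<in> U}" "x \<in> topspace X" by auto
    then have "nhd s g {x}" using Basis.prems by (simp add: nhd_def)
    then show ?case ..
  qed
  then obtain A where A: "nhd W g A" using assms(2) N by auto
  show thesis
  proof (rule that)
    show "finite A" "A \<subseteq> topspace X" using A by (simp_all add: nhd_def)
    show "h \<in> N" if "h \<in> Homeo X" "\<And>a. a \<in> A \<Longrightarrow> h a = g a" for h
      using A that N by (simp add: nhd_def)
  qed
qed

text \<open>An enumeration of \<open>A\<close> and its image under \<open>e\<close> are the two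
  tuples to which full transitivity applies.\<close>

lemma fully_transitive_extend:
  assumes "fully_transitive X" "finite A" "A \<subseteq> topspace X" "inj_on e A"
    and "\<And>a. a \<in> A \<Longrightarrow> e a \<in> sim_class X a"
  obtains g where "g \<in> Homeo X" "\<And>a. a \<in> A \<Longrightarrow> g a = e a"
proof -
  obtain xs where xs: "set xs = A" "distinct xs" using finite_distinct_list[OF assms(2)] by blast
  have "distinct (map e xs)" using xs assms(4) by (simp add: distinct_map)
  moreover have "set (map e xs) \<subseteq> topspace X" using xs assms(5) by (auto simp: sim_class_def)
  moreover have "\<forall>i<length xs. similar X (xs ! i) (map e xs ! i)"
    using xs assms(5) nth_mem[of _ xs] by (auto simp: sim_class_def)
  ultimately obtain g where g: "g \<in> Homeo X" "\<forall>i<length xs. g (xs ! i) = map e xs ! i"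
    using assms(1) xs assms(3) unfolding fully_transitive_def by (metis length_map)
  show thesis
  proof (rule that[OF g(1)])
    fix a assume "a \<in> A"
    then obtain i where "i < length xs" "xs ! i = a" using xs by (metis in_set_conv_nth)
    then show "g a = e a" using g(2) by auto
  qed
qed

subsection \<open>The spaces of linear orders\<close>

lemma similarity_class_subset: "C \<in> similarity_classes X \<Longrightarrow> C \<subseteq> topspace X"
  by (auto simp: similarity_classes_eq sim_class_def)

lemma LO_strict_linear_on: "r \<in> LO Y \<Longrightarrow> strict_linear_on (\<lambda>x y. r (x, y)) Y"
  unfolding LO_def strict_linear_on_def mem_Collect_eq imp_conjL by (elim conjE) (intro conjI)

lemma LO_extensional: "r \<in> LO Y \<Longrightarrow> r \<in> extensional (Y \<times> Y)"
  by (simp add: LO_def PiE_def)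

lemma LO_eqI:
  assumes "r \<in> LO Y" "s \<in> LO Y" "\<And>x y. x \<in> Y \<Longrightarrow> y \<in> Y \<Longrightarrow> r (x, y) = s (x, y)"
  shows "r = s"
proof
  fix p
  show "r p = s p"
  proof (cases "p \<in> Y \<times> Y")
    case True
    then show ?thesis using assms(3)[of "fst p" "snd p"] by auto
  next
    case False
    then show ?thesis
      using extensional_arb[OF LO_extensional[OF assms(1)]] extensional_arb[OF LO_extensional[OF assms(2)]] by metis
  qed
qed

lemma topspace_LO_top: "topspace (LO_top Y) = LO Y"
proof -
  have "LO Y \<subseteq> (Y \<times> Y) \<rightarrow>\<^sub>E UNIV" unfolding LO_def by (rule Collect_restrict)
  then show ?thesis by (simp add: LO_top_def Int_absorb1)
qed

text \<open>The strict part of a well-order of the whole type restricts to every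
  \<open>Y\<close>.\<close>

lemma LO_nonempty: "LO Y \<noteq> {}"
proof -
  obtain w :: "'a rel" where w: "well_order_on UNIV w"
    using well_order_on by blast
  define r where "r = (\<lambda>p\<in>Y \<times> Y. p \<in> w \<and> fst p \<noteq> snd p)"
  have "trans w" "antisym w" "total w"
    using w by (auto simp: well_order_on_def linear_order_on_def partial_order_on_def preorder_on_def)
  then have "r \<in> LO Y"
    unfolding LO_def r_def total_on_def by (auto dest: antisymD elim: transE)
  then show ?thesis by auto
qed

text \<open>Each axiom of a linear order, for fixed points, constrains finitely many coordinates.
  Quantifiers become intersections and disjunctions finite unions, which is why the implications are
  rewritten as disjunctions.\<close>

lemma closedin_LO: "closedin (product_topology (\<lambda>_. discrete_topology (UNIV :: bool set)) (Y \<times> Y)) (LO Y)"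
proof -
  let ?P = "product_topology (\<lambda>_. discrete_topology (UNIV :: bool set)) (Y \<times> Y)"
  have val: "closedin ?P {r \<in> topspace ?P. r p = b}" if "p \<in> Y \<times> Y" for p b
    using closedin_continuous_map_preimage[OF continuous_map_product_projection[OF that], of "\<lambda>_. discrete_topology UNIV" "{b}"]
    by simp
  have val': "closedin ?P {r \<in> topspace ?P. r p}" "closedin ?P {r \<in> topspace ?P. \<not> r p}" if "p \<in> Y \<times> Y" for p
    using val[OF that, of True] val[OF that, of False] by simp_all
  have ball: "closedin ?P {r \<in> topspace ?P. \<forall>x\<in>A. Q x r}"
    if "\<And>x. x \<in> A \<Longrightarrow> closedin ?P {r \<in> topspace ?P. Q x r}" for A :: "'a set" and Q
  proof (cases "A = {}")
    case True
    then show ?thesis using closedin_topspace[of ?P] by simp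
  next
    case False
    then have "{r \<in> topspace ?P. \<forall>x\<in>A. Q x r} = (\<Inter>x\<in>A. {r \<in> topspace ?P. Q x r})" by auto
    then show ?thesis using closedin_Inter[of "(\<lambda>x. {r \<in> topspace ?P. Q x r}) ` A" ?P] False that by auto
  qed
  have disj: "closedin ?P {r \<in> topspace ?P. Q r \<or> Q' r}"
    if "closedin ?P {r \<in> topspace ?P. Q r}" "closedin ?P {r \<in> topspace ?P. Q' r}" for Q Q'
  proof -
    have "{r \<in> topspace ?P. Q r \<or> Q' r} = {r \<in> topspace ?P. Q r} \<union> {r \<in> topspace ?P. Q' r}" by auto
    then show ?thesis using closedin_Un[OF that] by simp
  qed
  have 1: "closedin ?P {r \<in> topspace ?P. \<forall>x\<in>Y. \<not> r (x, x)}"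
    by (rule ball) (rule val'(2), simp)
  have 2: "closedin ?P {r \<in> topspace ?P. \<forall>x\<in>Y. \<forall>y\<in>Y. \<forall>z\<in>Y. \<not> r (x, y) \<or> \<not> r (y, z) \<or> r (x, z)}"
    by (intro ball disj val') simp_all
  have 3: "closedin ?P {r \<in> topspace ?P. \<forall>x\<in>Y. \<forall>y\<in>Y. x = y \<or> r (x, y) \<or> r (y, x)}"
  proof (intro ball)
    fix x y assume "x \<in> Y" "y \<in> Y"
    then have "closedin ?P {r \<in> topspace ?P. r (x, y) \<or> r (y, x)}" by (intro disj val') simp_all
    then show "closedin ?P {r \<in> topspace ?P. x = y \<or> r (x, y) \<or> r (y, x)}"
      using closedin_topspace[of ?P] by (cases "x = y") simp_all
  qed
  have "r \<in> LO Y \<longleftrightarrow> r \<in> {r \<in> topspace ?P. \<forall>x\<in>Y. \<not> r (x, x)} \<inter>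
      ({r \<in> topspace ?P. \<forall>x\<in>Y. \<forall>y\<in>Y. \<forall>z\<in>Y. \<not> r (x, y) \<or> \<not> r (y, z) \<or> r (x, z)} \<inter>
      {r \<in> topspace ?P. \<forall>x\<in>Y. \<forall>y\<in>Y. x = y \<or> r (x, y) \<or> r (y, x)})" (is "_ \<longleftrightarrow> r \<in> ?S") for r
  proof -
    have "(\<not> r (x, y) \<or> \<not> r (y, z) \<or> r (x, z)) = (r (x, y) \<and> r (y, z) \<longrightarrow> r (x, z))"
      "(x = y \<or> r (x, y) \<or> r (y, x)) = (x \<noteq> y \<longrightarrow> r (x, y) \<or> r (y, x))" for x y z
      by argo+
    note eqs = this
    show ?thesis
      unfolding LO_def eqs mem_Collect_eq Int_iff topspace_product_topology topspace_discrete_topology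
      by argo
  qed
  then have "LO Y = ?S" by (rule set_eqI)
  then show ?thesis using closedin_Int[OF 1 closedin_Int[OF 2 3]] by simp
qed

lemma compact_space_LO_top: "compact_space (LO_top Y)"
proof -
  have "compact_space (product_topology (\<lambda>_. discrete_topology (UNIV :: bool set)) (Y \<times> Y))"
    by (simp add: compact_space_product_topology compact_space_discrete_topology)
  then show ?thesis
    unfolding LO_top_def by (intro compact_space_subtopology closedin_compact_space closedin_LO)
qed

lemma Hausdorff_space_LO_top: "Hausdorff_space (LO_top Y)"
  unfolding LO_top_def
  by (intro Hausdorff_space_subtopology) (simp add: Hausdorff_space_product_topology)

lemma topspace_prod_LO_top: "topspace (prod_LO_top X) = PiE (similarity_classes X) LO"
  by (simp add: prod_LO_top_def topspace_LO_top)

lemma continuous_map_LO_eval: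
  assumes "x \<in> Y" "y \<in> Y"
  shows "continuous_map (LO_top Y) (discrete_topology UNIV) (\<lambda>r. r (x, y))"
  unfolding LO_top_def
  by (rule continuous_map_from_subtopology, rule continuous_map_product_projection) (use assms in simp)

lemma continuous_map_prod_LO_eval:
  assumes "C \<in> similarity_classes X" "x \<in> C" "y \<in> C"
  shows "continuous_map (prod_LO_top X) (discrete_topology UNIV) (\<lambda>R. R C (x, y))"
proof -
  have "continuous_map (prod_LO_top X) (LO_top C) (\<lambda>R. R C)"
    unfolding prod_LO_top_def by (rule continuous_map_product_projection[OF assms(1)])
  from continuous_map_compose[OF this continuous_map_LO_eval[OF assms(2,3)]]
  show ?thesis by (simp add: comp_def)
qed

lemma openin_prod_LO_eval:
  assumes "C \<in> similarity_classes X" "x \<in> C" "y \<in> C"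
  shows "openin (prod_LO_top X) {R \<in> topspace (prod_LO_top X). R C (x, y) = b}"
  using openin_continuous_map_preimage[OF continuous_map_prod_LO_eval[OF assms], of "{b}"] by simp

text \<open>A basic box constrains finitely many pairs; \<open>A\<close> collects both components of
  these pairs, so that a neighbourhood is described by a set of points.\<close>

lemma LO_top_nhd_finite:
  assumes "openin (LO_top Y) W" "r \<in> W"
  obtains A where "finite A" "A \<subseteq> Y"
    "\<And>s. s \<in> LO Y \<Longrightarrow> (\<And>x y. x \<in> A \<Longrightarrow> y \<in> A \<Longrightarrow> s (x, y) = r (x, y)) \<Longrightarrow> s \<in> W"
proof -
  obtain V where V: "openin (product_topology (\<lambda>_. discrete_topology (UNIV :: bool set)) (Y \<times> Y)) V"
    and W: "W = V \<inter> LO Y"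
    using assms(1) unfolding LO_top_def openin_subtopology by auto
  then obtain U where U: "finite {p \<in> Y \<times> Y. U p \<noteq> (UNIV :: bool set)}"
    "r \<in> PiE (Y \<times> Y) U" "PiE (Y \<times> Y) U \<subseteq> V"
    using V[unfolded openin_product_topology_alt, rule_format, of r] assms(2) by auto
  define F where "F = {p \<in> Y \<times> Y. U p \<noteq> (UNIV :: bool set)}"
  show thesis
  proof (rule that)
    show "finite (fst ` F \<union> snd ` F)" using U(1) by (simp add: F_def)
    show "fst ` F \<union> snd ` F \<subseteq> Y" by (auto simp: F_def)
    fix s assume s: "s \<in> LO Y" "\<And>x y. x \<in> fst ` F \<union> snd ` F \<Longrightarrow> y \<in> fst ` F \<union> snd ` F \<Longrightarrow> s (x, y) = r (x, y)"
    have "s \<in> PiE (Y \<times> Y) U"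
    proof (rule PiE_I)
      fix p assume p: "p \<in> Y \<times> Y"
      show "s p \<in> U p"
      proof (cases "p \<in> F")
        case True
        then have "s (fst p, snd p) = r (fst p, snd p)" by (intro s(2)) auto
        then show ?thesis using PiE_mem[OF U(2) p] by simp
      next
        case False
        then have "U p = UNIV" using p by (simp add: F_def)
        then show ?thesis by simp
      qed
    next
      fix p assume "p \<notin> Y \<times> Y"
      then show "s p = undefined" by (rule extensional_arb[OF LO_extensional[OF s(1)]])
    qed
    then show "s \<in> W" using U(3) W s(1) by auto
  qed
qed

lemma prod_LO_top_nhd_finite:
  assumes "openin (prod_LO_top X) W" "R \<in> W"
  obtains A where "finite A" "A \<subseteq> topspace X"
    "\<And>S. S \<in> topspace (prod_LO_top X) \<Longrightarrow>
      (\<And>C x y. C \<in> similarity_classes X \<Longrightarrow> x \<in> A \<inter> C \<Longrightarrow> y \<in> A \<inter> C \<Longrightarrow> S C (x, y) = R C (x, y)) \<Longrightarrow> S \<in> W"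
proof -
  let ?K = "similarity_classes X"
  obtain U where U: "finite {C \<in> ?K. U C \<noteq> LO C}" "\<And>C. C \<in> ?K \<Longrightarrow> openin (LO_top C) (U C)"
    "R \<in> PiE ?K U" "PiE ?K U \<subseteq> W"
    using assms(1)[unfolded prod_LO_top_def openin_product_topology_alt topspace_LO_top] assms(2)
    by meson
  define ok where "ok = (\<lambda>C A. finite A \<and> A \<subseteq> C \<and>
    (\<forall>s\<in>LO C. (\<forall>x\<in>A. \<forall>y\<in>A. s (x, y) = R C (x, y)) \<longrightarrow> s \<in> U C))"
  have "\<exists>A. ok C A" if C: "C \<in> ?K" for C
  proof -
    obtain A where "finite A" "A \<subseteq> C"
      "\<And>s. s \<in> LO C \<Longrightarrow> (\<And>x y. x \<in> A \<Longrightarrow> y \<in> A \<Longrightarrow> s (x, y) = R C (x, y)) \<Longrightarrow> s \<in> U C"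
      using LO_top_nhd_finite[OF U(2)[OF C] PiE_mem[OF U(3) C]] by blast
    then have "ok C A" by (simp add: ok_def)
    then show ?thesis ..
  qed
  then obtain A where ok: "\<And>C. C \<in> ?K \<Longrightarrow> ok C (A C)" by metis
  then have A: "\<And>C. C \<in> ?K \<Longrightarrow> finite (A C)" "\<And>C. C \<in> ?K \<Longrightarrow> A C \<subseteq> C"
    "\<And>C s. C \<in> ?K \<Longrightarrow> s \<in> LO C \<Longrightarrow> (\<forall>x\<in>A C. \<forall>y\<in>A C. s (x, y) = R C (x, y)) \<Longrightarrow> s \<in> U C"
    by (simp_all add: ok_def)
  define F where "F = {C \<in> ?K. U C \<noteq> LO C}"
  show thesis
  proof (rule that)
    show "finite (\<Union>C\<in>F. A C)" using U(1) A(1) by (auto simp: F_def)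
    show "(\<Union>C\<in>F. A C) \<subseteq> topspace X"
    proof (rule UN_least)
      fix C assume "C \<in> F"
      then have "C \<in> ?K" by (simp add: F_def)
      then show "A C \<subseteq> topspace X" using A(2)[of C] similarity_class_subset[of C X] by simp
    qed
    fix S assume S: "S \<in> topspace (prod_LO_top X)"
      and eq: "\<And>C x y. C \<in> ?K \<Longrightarrow> x \<in> (\<Union>C\<in>F. A C) \<inter> C \<Longrightarrow> y \<in> (\<Union>C\<in>F. A C) \<inter> C \<Longrightarrow> S C (x, y) = R C (x, y)"
    have S': "S \<in> PiE ?K LO" using S by (simp add: topspace_prod_LO_top)
    have "S \<in> PiE ?K U"
    proof (rule PiE_I)
      fix C assume C: "C \<in> ?K"
      show "S C \<in> U C"
      proof (cases "C \<in> F")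
        case True
        show ?thesis
        proof (rule A(3)[OF C PiE_mem[OF S' C]], intro ballI)
          fix x y assume "x \<in> A C" "y \<in> A C"
          then show "S C (x, y) = R C (x, y)" using True A(2)[OF C] by (intro eq[OF C]) auto
        qed
      next
        case False
        then show ?thesis using PiE_mem[OF S' C] C by (simp add: F_def)
      qed
    next
      fix C assume "C \<notin> ?K"
      then show "S C = undefined" using S' by (simp add: PiE_def extensional_def)
    qed
    then show "S \<in> W" using U(4) by auto
  qed
qed

lemma LO_I:
  assumes "r \<in> extensional (Y \<times> Y)" "strict_linear_on (\<lambda>x y. r (x, y)) Y"
  shows "r \<in> LO Y"
  using assms unfolding LO_def strict_linear_on_def mem_Collect_eq imp_conjL PiE_def
  by (elim conjE) (intro conjI IntI, simp)

lemma strict_linear_on_pullback: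
  assumes "strict_linear_on q S" "inj_on u A" "u ` A \<subseteq> S"
  shows "strict_linear_on (\<lambda>x y. q (u x) (u y)) A"
proof -
  have S: "u x \<in> S" if "x \<in> A" for x using assms(3) that by auto
  show ?thesis
    unfolding strict_linear_on_def
  proof (intro conjI ballI impI)
    fix x y z assume "x \<in> A" "y \<in> A" "z \<in> A" "q (u x) (u y)" "q (u y) (u z)"
    then show "q (u x) (u z)" using strict_linear_onD(2)[OF assms(1) S S S] by metis
  next
    fix x y assume "x \<in> A" "y \<in> A" "x \<noteq> y"
    then show "q (u x) (u y) \<or> q (u y) (u x)"
      using strict_linear_onD(3)[OF assms(1) S S] inj_onD[OF assms(2)] by metis
  qed (use strict_linear_onD(1)[OF assms(1) S] in simp)
qed

lemma Homeo_similarity_class: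
  assumes "g \<in> Homeo X" "C \<in> similarity_classes X" "x \<in> C"
  shows "g x \<in> C"
  using assms Homeo_sim_class[OF assms(1)] by (auto simp: similarity_classes_eq)

lemma prod_LO_strict_linear_on:
  assumes "R \<in> topspace (prod_LO_top X)" "C \<in> similarity_classes X"
  shows "strict_linear_on (\<lambda>x y. R C (x, y)) C"
  using LO_strict_linear_on[OF PiE_mem[of R "similarity_classes X" LO C]] assms
  by (simp add: topspace_prod_LO_top)

lemma prod_LO_eqI:
  assumes "R \<in> topspace (prod_LO_top X)" "S \<in> topspace (prod_LO_top X)"
    and "\<And>C x y. C \<in> similarity_classes X \<Longrightarrow> x \<in> C \<Longrightarrow> y \<in> C \<Longrightarrow> R C (x, y) = S C (x, y)"
  shows "R = S"
proof -
  have R: "R \<in> PiE (similarity_classes X) LO" and S: "S \<in> PiE (similarity_classes X) LO"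
    using assms(1,2) by (simp_all add: topspace_prod_LO_top)
  show ?thesis
  proof (rule PiE_ext[OF R S])
    fix C assume C: "C \<in> similarity_classes X"
    show "R C = S C" by (rule LO_eqI[OF PiE_mem[OF R C] PiE_mem[OF S C] assms(3)[OF C]])
  qed
qed

section \<open>The action on the product of the spaces of linear orders\<close>

lemma LO_act_apply:
  assumes "g \<in> Homeo X" "C \<in> similarity_classes X" "x \<in> C" "y \<in> C"
  shows "LO_act X g R C (x, y) = R C (inv g x, inv g y)"
  using assms inv_into_Homeo[OF assms(1)] similarity_class_subset[OF assms(2)]
  by (simp add: LO_act_def subset_iff)

lemma LO_act_topspace:
  assumes g: "g \<in> Homeo X" and R: "R \<in> topspace (prod_LO_top X)"
  shows "LO_act X g R \<in> topspace (prod_LO_top X)"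
  unfolding topspace_prod_LO_top
proof (rule PiE_I)
  fix C assume C: "C \<in> similarity_classes X"
  have "strict_linear_on (\<lambda>x y. R C (inv g x, inv g y)) C"
  proof (rule strict_linear_on_pullback[OF prod_LO_strict_linear_on[OF R C]])
    show "inj_on (inv g) C"
      using bij_Homeo[OF Homeo_inv[OF g]] by (meson bij_is_inj inj_on_subset subset_UNIV)
    show "inv g ` C \<subseteq> C"
      using Homeo_similarity_class[OF Homeo_inv[OF g] C] by auto
  qed
  moreover have "strict_linear_on (\<lambda>x y. LO_act X g R C (x, y)) C \<longleftrightarrow>
      strict_linear_on (\<lambda>x y. R C (inv g x, inv g y)) C"
    unfolding strict_linear_on_def using LO_act_apply[OF g C] by (simp cong: ball_cong)
  moreover have "LO_act X g R C \<in> extensional (C \<times> C)" using C by (simp add: LO_act_def)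
  ultimately show "LO_act X g R C \<in> LO C" by (intro LO_I) blast+
next
  fix C assume "C \<notin> similarity_classes X"
  then show "LO_act X g R C = undefined" by (simp add: LO_act_def)
qed

lemma topspace_Homeo_top_subset: "topspace (Homeo_top X) \<subseteq> Homeo X"
  by (simp add: Homeo_top_def)

text \<open>A coordinate of the image depends on \<open>g\<close> only through the two points
  \<open>inv g x\<close> and \<open>inv g y\<close>, and these are locally constant in
  \<open>g\<close>.\<close>

lemma continuous_map_LO_act:
  assumes "scattered_space X"
  shows "continuous_map (prod_topology (Homeo_top X) (prod_LO_top X)) (prod_LO_top X)
    (\<lambda>(g, R). LO_act X g R)"
proof -
  let ?G = "Homeo_top X" and ?P = "prod_LO_top X"
  let ?f = "\<lambda>(g, R). LO_act X g R"
  have act: "?f z \<in> topspace ?P" if "z \<in> topspace (prod_topology ?G ?P)" for z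
    using that LO_act_topspace[of _ X] topspace_Homeo_top_subset[of X]
    by (cases z) (simp add: topspace_prod_topology subset_iff)
  have eval: "continuous_map (prod_topology ?G ?P) (discrete_topology UNIV) (\<lambda>z. ?f z C (x, y))"
    if C: "C \<in> similarity_classes X" and xy: "x \<in> C" "y \<in> C" for C x y
    unfolding continuous_map_def
  proof (intro conjI allI impI)
    fix B :: "bool set"
    show "openin (prod_topology ?G ?P) {z \<in> topspace (prod_topology ?G ?P). ?f z C (x, y) \<in> B}"
      unfolding openin_prod_topology_alt
    proof (intro allI impI)
      fix g R assume "(g, R) \<in> {z \<in> topspace (prod_topology ?G ?P). ?f z C (x, y) \<in> B}"
      then have g: "g \<in> topspace ?G" "g \<in> Homeo X" and R: "R \<in> topspace ?P" and B: "LO_act X g R C (x, y) \<in> B"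
        using topspace_Homeo_top_subset[of X] by (auto simp: topspace_prod_topology)
      define u v where "u = inv g x" and "v = inv g y"
      have uv: "u \<in> C" "v \<in> C" "g u = x" "g v = y"
        using Homeo_similarity_class[OF Homeo_inv[OF g(2)] C] xy bij_Homeo[OF g(2)]
        by (simp_all add: u_def v_def bij_is_surj surj_f_inv_f)
      have T: "u \<in> topspace X" "v \<in> topspace X" using uv similarity_class_subset[OF C] by auto
      \<comment> \<open>Fixing the values at \<open>u\<close> and \<open>v\<close>, rather than
        those of the inverse at \<open>x\<close> and \<open>y\<close>, gives sets known to be open;
        by injectivity it also fixes the inverse at \<open>x\<close> and \<open>y\<close>.\<close>
      define N where "N = {h \<in> Homeo X. h u = x} \<inter> {h \<in> Homeo X. h v = y}"
      define M where "M = {S \<in> topspace ?P. S C (u, v) = R C (u, v)}"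
      have "openin ?G N" "openin ?P M"
        unfolding N_def M_def
        using openin_Homeo_top_eval[OF assms] T openin_prod_LO_eval[OF C uv(1,2)] by (simp_all add: openin_Int)
      moreover have "g \<in> N" "R \<in> M" using g R uv by (simp_all add: N_def M_def)
      moreover have "N \<times> M \<subseteq> {z \<in> topspace (prod_topology ?G ?P). ?f z C (x, y) \<in> B}"
      proof
        fix z assume "z \<in> N \<times> M"
        then obtain h S where z: "z = (h, S)" "h \<in> N" "S \<in> M" by auto
        have h: "h \<in> Homeo X" "h u = x" "h v = y" using z by (auto simp: N_def)
        have "inv h x = u" "inv h y = v"
          using h bij_is_inj[OF bij_Homeo[OF h(1)]] by (auto intro: inv_f_eq)
        then have "LO_act X h S C (x, y) = LO_act X g R C (x, y)"
          using LO_act_apply[OF h(1) C xy] LO_act_apply[OF g(2) C xy] z(3) by (simp add: M_def u_def v_def)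
        moreover have "h \<in> topspace ?G" using \<open>openin ?G N\<close> z(2) openin_subset by auto
        moreover have "S \<in> topspace ?P" using z(3) by (simp add: M_def)
        ultimately show "z \<in> {z \<in> topspace (prod_topology ?G ?P). ?f z C (x, y) \<in> B}"
          using z(1) B by (simp add: topspace_prod_topology)
      qed
      ultimately show "\<exists>U V. openin ?G U \<and> openin ?P V \<and> g \<in> U \<and> R \<in> V \<and>
          U \<times> V \<subseteq> {z \<in> topspace (prod_topology ?G ?P). ?f z C (x, y) \<in> B}" by blast
    qed
  qed simp
  have mem: "?f z C \<in> LO C" if "z \<in> topspace (prod_topology ?G ?P)" "C \<in> similarity_classes X" for z C
    using act[OF that(1)] that(2) PiE_mem[of "?f z" "similarity_classes X" LO C] by (simp add: topspace_prod_LO_top)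
  have "continuous_map (prod_topology ?G ?P) (LO_top C) (\<lambda>z. ?f z C)"
    if C: "C \<in> similarity_classes X" for C
    unfolding LO_top_def continuous_map_in_subtopology continuous_map_componentwise
  proof (intro conjI ballI)
    show "(\<lambda>z. ?f z C) ` topspace (prod_topology ?G ?P) \<subseteq> extensional (C \<times> C)"
      using mem[OF _ C] LO_extensional by blast
    show "(\<lambda>z. ?f z C) \<in> topspace (prod_topology ?G ?P) \<rightarrow> LO C"
      using mem[OF _ C] by (rule Pi_I)
    fix p assume "p \<in> C \<times> C"
    then show "continuous_map (prod_topology ?G ?P) (discrete_topology UNIV) (\<lambda>z. ?f z C p)"
      using eval[OF C, of "fst p" "snd p"] by (simp add: mem_Times_iff)
  qed
  moreover have "?f ` topspace (prod_topology ?G ?P) \<subseteq> extensional (similarity_classes X)"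
    using act by (auto simp: topspace_prod_LO_top PiE_def)
  ultimately show ?thesis
    unfolding prod_LO_top_def[of X] continuous_map_componentwise by (simp add: prod_LO_top_def)
qed

lemma is_flow_prod_LO:
  assumes "scattered_space X"
  shows "is_flow (Homeo_top X) (prod_LO_top X) (LO_act X)"
  unfolding is_flow_def
proof (intro conjI ballI)
  let ?P = "prod_LO_top X"
  show "topspace ?P \<noteq> {}" using LO_nonempty by (auto simp: topspace_prod_LO_top PiE_eq_empty_iff)
  show "compact_space ?P"
    unfolding prod_LO_top_def by (simp add: compact_space_product_topology compact_space_LO_top)
  show "Hausdorff_space ?P"
    unfolding prod_LO_top_def by (simp add: Hausdorff_space_product_topology Hausdorff_space_LO_top)
  show "continuous_map (prod_topology (Homeo_top X) ?P) ?P (\<lambda>(g, R). LO_act X g R)"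
    by (rule continuous_map_LO_act[OF assms])
  fix R assume R: "R \<in> topspace ?P"
  show "LO_act X id R = R"
    by (rule prod_LO_eqI[OF LO_act_topspace[OF Homeo_id R] R]) (simp add: LO_act_apply[OF Homeo_id])
  fix g assume "g \<in> topspace (Homeo_top X)"
  then have g: "g \<in> Homeo X" using topspace_Homeo_top_subset by auto
  show "LO_act X g R \<in> topspace ?P" by (rule LO_act_topspace[OF g R])
  fix h assume "h \<in> topspace (Homeo_top X)"
  then have h: "h \<in> Homeo X" using topspace_Homeo_top_subset by auto
  show "LO_act X (g \<circ> h) R = LO_act X g (LO_act X h R)"
  proof (rule prod_LO_eqI[OF LO_act_topspace[OF Homeo_comp[OF g h] R] LO_act_topspace[OF g LO_act_topspace[OF h R]]])
    fix C x y assume C: "C \<in> similarity_classes X" and xy: "x \<in> C" "y \<in> C"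
    note xy' = Homeo_similarity_class[OF Homeo_inv[OF g] C xy(1)] Homeo_similarity_class[OF Homeo_inv[OF g] C xy(2)]
    show "LO_act X (g \<circ> h) R C (x, y) = LO_act X g (LO_act X h R) C (x, y)"
      unfolding LO_act_apply[OF Homeo_comp[OF g h] C xy] LO_act_apply[OF g C xy] LO_act_apply[OF h C xy']
      by (simp add: o_inv_distrib bij_Homeo[OF g] bij_Homeo[OF h])
  qed
qed


section \<open>Density of the orbits of linear orders\<close>

lemma similarity_class_eq: "C \<in> similarity_classes X \<Longrightarrow> x \<in> C \<Longrightarrow> sim_class X x = C"
  unfolding similarity_classes_eq by (elim imageE) (simp only: sim_class_eq)

text \<open>On each finite \<open>A \<inter> C\<close> the orders \<open>R C\<close> and
  \<open>S C\<close> are isomorphic. The isomorphisms for the various classes form one injection of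
  \<open>A\<close> that respects the classes, and full transitivity extends it.\<close>

lemma LO_act_approximates:
  assumes ft: "fully_transitive X" and A: "finite A" "A \<subseteq> topspace X"
    and R: "R \<in> topspace (prod_LO_top X)" and S: "S \<in> topspace (prod_LO_top X)"
  obtains g where "g \<in> Homeo X"
    "\<And>C x y. C \<in> similarity_classes X \<Longrightarrow> x \<in> A \<inter> C \<Longrightarrow> y \<in> A \<inter> C \<Longrightarrow> LO_act X g R C (x, y) = S C (x, y)"
proof -
  define iso where "iso = (\<lambda>C u. bij_betw u (A \<inter> C) (A \<inter> C) \<and>
    (\<forall>x\<in>A \<inter> C. \<forall>y\<in>A \<inter> C. R C (u x, u y) = S C (x, y)))"
  have "\<exists>u. iso C u" if C: "C \<in> similarity_classes X" for C
  proof -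
    have "finite (A \<inter> C)" using A(1) by simp
    moreover have "strict_linear_on (\<lambda>x y. R C (x, y)) (A \<inter> C)" "strict_linear_on (\<lambda>x y. S C (x, y)) (A \<inter> C)"
      using prod_LO_strict_linear_on[OF R C] prod_LO_strict_linear_on[OF S C]
      by (auto intro: strict_linear_on_subset)
    ultimately obtain u where "bij_betw u (A \<inter> C) (A \<inter> C)"
      "\<And>x y. x \<in> A \<inter> C \<Longrightarrow> y \<in> A \<inter> C \<Longrightarrow> R C (u x, u y) = S C (x, y)"
      by (rule finite_order_iso_exists) blast
    then show ?thesis unfolding iso_def by blast
  qed
  then obtain u where u: "\<And>C. C \<in> similarity_classes X \<Longrightarrow> iso C (u C)" by metis
  define e where "e = (\<lambda>x. u (sim_class X x) x)"
  have e_class: "e x \<in> A \<inter> sim_class X x" if "x \<in> A" for x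
  proof -
    have "x \<in> topspace X" using that A(2) by auto
    then have "x \<in> A \<inter> sim_class X x" "iso (sim_class X x) (u (sim_class X x))"
      using that sim_class_self u by (auto simp: similarity_classes_eq)
    then show ?thesis unfolding e_def iso_def bij_betw_def by auto
  qed
  have "inj_on e A"
  proof (rule inj_onI)
    fix x y assume xy: "x \<in> A" "y \<in> A" "e x = e y"
    have T: "x \<in> topspace X" "y \<in> topspace X" using xy A(2) by auto
    have "sim_class X x = sim_class X y"
      using e_class[OF xy(1)] e_class[OF xy(2)] xy(3) sim_class_eq[of "e x" X x] sim_class_eq[of "e x" X y] by auto
    moreover from this have "u (sim_class X x) x = u (sim_class X x) y" using xy(3) by (simp add: e_def)
    moreover have "inj_on (u (sim_class X x)) (A \<inter> sim_class X x)"
      using u[of "sim_class X x"] T by (simp add: similarity_classes_eq iso_def bij_betw_def)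
    ultimately show "x = y" using sim_class_self[OF T(1)] sim_class_self[OF T(2)] xy(1,2) by (auto dest: inj_onD)
  qed
  then obtain k where k: "k \<in> Homeo X" "\<And>a. a \<in> A \<Longrightarrow> k a = e a"
    using fully_transitive_extend[OF ft A] e_class by blast
  \<comment> \<open>The action pulls back along the inverse, so the homeomorphism extending
    \<open>e\<close> has to be inverted.\<close>
  show thesis
  proof (rule that[OF Homeo_inv[OF k(1)]])
    fix C x y assume C: "C \<in> similarity_classes X" and x: "x \<in> A \<inter> C" and y: "y \<in> A \<inter> C"
    have "k x = u C x" "k y = u C y"
      using k(2) x y similarity_class_eq[OF C] by (simp_all add: e_def)
    then show "LO_act X (inv k) R C (x, y) = S C (x, y)"
      using u[OF C] x y LO_act_apply[OF Homeo_inv[OF k(1)] C, of x y]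
      by (simp add: inv_inv_eq[OF bij_Homeo[OF k(1)]] iso_def)
  qed
qed

lemma is_minimal_flow_prod_LO:
  assumes "scattered_space X" "fully_transitive X"
  shows "is_minimal_flow (Homeo_top X) (prod_LO_top X) (LO_act X)"
  unfolding is_minimal_flow_def
proof (intro conjI allI impI is_flow_prod_LO[OF assms(1)], elim conjE)
  let ?P = "prod_LO_top X"
  fix Z assume Z: "closedin ?P Z" "Z \<noteq> {}" and inv: "\<forall>g\<in>topspace (Homeo_top X). \<forall>z\<in>Z. LO_act X g z \<in> Z"
  obtain R where R: "R \<in> Z" "R \<in> topspace ?P" using Z closedin_subset by blast
  have "S \<in> Z" if S: "S \<in> topspace ?P" for S
  proof (cases "topspace X = {}")
    case True
    \<comment> \<open>Without classes the product is a single point; this case is separate because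
      \<open>Homeo_top X\<close> then has empty carrier and supplies no translates.\<close>
    have "S = R"
      by (rule prod_LO_eqI[OF S R(2)]) (simp add: similarity_classes_eq True)
    then show ?thesis using R(1) by simp
  next
    case False
    show ?thesis
    proof (rule ccontr)
      assume "S \<notin> Z"
      then have "openin ?P (topspace ?P - Z)" "S \<in> topspace ?P - Z" using Z(1) S by auto
      then obtain A where A: "finite A" "A \<subseteq> topspace X"
        "\<And>S'. S' \<in> topspace ?P \<Longrightarrow> (\<And>C x y. C \<in> similarity_classes X \<Longrightarrow> x \<in> A \<inter> C \<Longrightarrow> y \<in> A \<inter> C \<Longrightarrow>
          S' C (x, y) = S C (x, y)) \<Longrightarrow> S' \<in> topspace ?P - Z"
        using prod_LO_top_nhd_finite[of X "topspace ?P - Z" S] by metis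
      obtain g where g: "g \<in> Homeo X" "\<And>C x y. C \<in> similarity_classes X \<Longrightarrow> x \<in> A \<inter> C \<Longrightarrow> y \<in> A \<inter> C \<Longrightarrow>
          LO_act X g R C (x, y) = S C (x, y)"
        using LO_act_approximates[OF assms(2) A(1,2) R(2) S] by metis
      have "LO_act X g R \<in> topspace ?P - Z" using A(3)[OF LO_act_topspace[OF g(1) R(2)] g(2)] .
      moreover have "LO_act X g R \<in> Z" using inv g(1) R(1) topspace_Homeo_top[OF False] by simp
      ultimately show False by simp
    qed
  qed
  then show "Z = topspace ?P" using closedin_subset[OF Z(1)] by auto
qed

subsection \<open>Maps between minimal flows\<close>

lemma flow_point:
  assumes "is_flow TG Y act"
  obtains y where "y \<in> topspace Y"
  using assms unfolding is_flow_def by (meson ex_in_conv)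

lemma flow_continuous_map_act:
  assumes "is_flow TG Y act" "g \<in> topspace TG"
  shows "continuous_map Y Y (act g)"
proof -
  have "continuous_map Y (prod_topology TG Y) (\<lambda>y. (g, y))"
    by (simp add: continuous_map_pairwise comp_def assms(2))
  moreover have "continuous_map (prod_topology TG Y) Y (\<lambda>(g, y). act g y)"
    using assms(1) by (simp add: is_flow_def)
  ultimately have "continuous_map Y Y ((\<lambda>(g, y). act g y) \<circ> (\<lambda>y. (g, y)))"
    by (rule continuous_map_compose)
  then show ?thesis by (simp add: comp_def)
qed

lemma minimal_flow_continuous_image:
  assumes M: "is_minimal_flow TG M actM" and Z: "compactin T Z" "Z \<noteq> {}"
    and f: "continuous_map T M f"
    and inv: "\<And>g z. g \<in> topspace TG \<Longrightarrow> z \<in> Z \<Longrightarrow> actM g (f z) \<in> f ` Z"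
  shows "f ` Z = topspace M"
proof -
  have "Hausdorff_space M" using M by (simp add: is_minimal_flow_def is_flow_def)
  then have "closedin M (f ` Z)" using image_compactin[OF Z(1) f] compactin_imp_closedin by blast
  moreover have "f ` Z \<noteq> {}" using Z(2) by simp
  moreover have "\<forall>g\<in>topspace TG. \<forall>z\<in>f ` Z. actM g z \<in> f ` Z" using inv by auto
  ultimately show ?thesis using M unfolding is_minimal_flow_def by meson
qed

text \<open>No formula for the factor map is available, only a closed invariant relation. Its two
  projections are onto by minimality, and equivariance follows from invariance together with
  single-valuedness.\<close>

lemma flow_maps_onto_of_graph:
  assumes M: "is_minimal_flow TG M actM" and Y: "is_minimal_flow TG Y actY"
    and Z: "closedin (prod_topology M Y) Z" "Z \<noteq> {}"
    and inv: "\<And>g m y. g \<in> topspace TG \<Longrightarrow> (m, y) \<in> Z \<Longrightarrow> (actM g m, actY g y) \<in> Z"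
    and single: "\<And>m y y'. (m, y) \<in> Z \<Longrightarrow> (m, y') \<in> Z \<Longrightarrow> y = y'"
  shows "flow_maps_onto TG M actM Y actY"
proof -
  let ?T = "prod_topology M Y"
  have comp: "compact_space M" "compact_space Y" and haus: "Hausdorff_space M"
    using M Y by (simp_all add: is_minimal_flow_def is_flow_def)
  have cZ: "compactin ?T Z"
    by (rule closedin_compact_space[OF _ Z(1)]) (simp add: compact_space_prod_topology comp)
  have ZT: "topspace (subtopology ?T Z) = Z" using closedin_subset[OF Z(1)] by auto
  have fstZ: "fst ` Z = topspace M"
    by (rule minimal_flow_continuous_image[OF M cZ Z(2) continuous_map_fst]) (use inv in force)
  have sndZ: "snd ` Z = topspace Y"
    by (rule minimal_flow_continuous_image[OF Y cZ Z(2) continuous_map_snd]) (use inv in force)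
  \<comment> \<open>A continuous bijection from a compact space to a Hausdorff space is a
    homeomorphism; its inverse followed by \<open>snd\<close> is the factor map.\<close>
  have "homeomorphic_map (subtopology ?T Z) M fst"
  proof (rule continuous_imp_homeomorphic_map[OF _ compact_space_subtopology[OF cZ] haus])
    show "continuous_map (subtopology ?T Z) M fst"
      by (rule continuous_map_from_subtopology[OF continuous_map_fst])
    show "fst ` topspace (subtopology ?T Z) = topspace M" using fstZ ZT by simp
    show "inj_on fst (topspace (subtopology ?T Z))"
      unfolding ZT using single by (auto intro!: inj_onI)
  qed
  then obtain k where k: "homeomorphic_maps (subtopology ?T Z) M fst k"
    using homeomorphic_map_maps by blast
  have kZ: "k m \<in> Z \<and> fst (k m) = m" if "m \<in> topspace M" for m
    using k that ZT unfolding homeomorphic_maps_def continuous_map_def by auto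
  have graph: "y = snd (k m)" if "(m, y) \<in> Z" for m y
  proof -
    have "m \<in> topspace M" using that fstZ by force
    then have "(m, snd (k m)) \<in> Z" using kZ[of m] by (metis prod.collapse)
    then show ?thesis using single that by blast
  qed
  show ?thesis
    unfolding flow_maps_onto_def
  proof (intro exI conjI ballI)
    have "continuous_map M ?T k"
      using k unfolding homeomorphic_maps_def continuous_map_in_subtopology by simp
    from continuous_map_compose[OF this continuous_map_snd]
    show "continuous_map M Y (snd \<circ> k)" .
    have "y \<in> (snd \<circ> k) ` topspace M" if y: "y \<in> topspace Y" for y
    proof -
      obtain m where "(m, y) \<in> Z" using y sndZ by force
      then have "y = (snd \<circ> k) m" "m \<in> topspace M" using graph fstZ by force+
      then show ?thesis by blast
    qed
    moreover have "(snd \<circ> k) m \<in> topspace Y" if "m \<in> topspace M" for m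
      using kZ[OF that] sndZ by force
    ultimately show "(snd \<circ> k) ` topspace M = topspace Y" by blast
    fix g m assume g: "g \<in> topspace TG" and m: "m \<in> topspace M"
    have "(m, snd (k m)) \<in> Z" using kZ[OF m] by (metis prod.collapse)
    from graph[OF inv[OF g this]]
    show "(snd \<circ> k) (actM g m) = actY g ((snd \<circ> k) m)" by simp
  qed
qed

text \<open>The pairs whose action avoids \<open>L\<close> form an open set containing
  \<open>{id} \<times> K\<close>. As \<open>K\<close> is compact, the tube lemma gives a
  neighbourhood of \<open>id\<close> that works for all of \<open>K\<close>, and it contains a
  pointwise stabiliser.\<close>

lemma Homeo_flow_stabilizer_separation:
  assumes "topspace X \<noteq> {}" and Y: "is_flow (Homeo_top X) Y act"
    and K: "closedin Y K" and L: "closedin Y L" and KL: "K \<inter> L = {}"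
  obtains A where "finite A" "A \<subseteq> topspace X"
    "\<And>v z. v \<in> Homeo X \<Longrightarrow> (\<And>a. a \<in> A \<Longrightarrow> v a = a) \<Longrightarrow> z \<in> K \<Longrightarrow> act v z \<notin> L"
proof -
  let ?G = "Homeo_top X"
  have id: "id \<in> topspace ?G" using topspace_Homeo_top[OF assms(1)] Homeo_id by simp
  have cY: "compact_space Y" and cont: "continuous_map (prod_topology ?G Y) Y (\<lambda>(g, y). act g y)"
    and act_id: "\<And>y. y \<in> topspace Y \<Longrightarrow> act id y = y"
    using Y by (simp_all add: is_flow_def)
  define W where "W = {z \<in> topspace (prod_topology ?G Y). (\<lambda>(g, y). act g y) z \<in> topspace Y - L}"
  have W: "openin (prod_topology ?G Y) W"
    unfolding W_def by (rule openin_continuous_map_preimage[OF cont]) (use L in auto)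
  have "(id, y) \<in> W" if "y \<in> K" for y
  proof -
    have "y \<in> topspace Y" "y \<notin> L" using that closedin_subset[OF K] KL by auto
    then show ?thesis using id by (simp add: W_def act_id del: id_apply)
  qed
  then have "{id} \<times> K \<subseteq> W" by auto
  from tube_lemma_right[OF W closedin_compact_space[OF cY K] id this]
  obtain N V where N: "openin ?G N" "id \<in> N" "K \<subseteq> V" "N \<times> V \<subseteq> W" by blast
  obtain A where A: "finite A" "A \<subseteq> topspace X"
    "\<And>h. h \<in> Homeo X \<Longrightarrow> (\<And>a. a \<in> A \<Longrightarrow> h a = id a) \<Longrightarrow> h \<in> N"
    using Homeo_top_nhd_stabilizer[OF N(1,2)] by blast
  show thesis
  proof (rule that[OF A(1,2)])
    fix v z assume "v \<in> Homeo X" "\<And>a. a \<in> A \<Longrightarrow> v a = a" "z \<in> K"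
    then have "(v, z) \<in> N \<times> V" using A(3)[of v] N(3) by auto
    then show "act v z \<notin> L" using N(4) by (auto simp: W_def)
  qed
qed

subsection \<open>Ramsey theory of similarity-preserving injections\<close>

text \<open>
  Ramsey's theorem is useless inside a finite class, but two homeomorphisms inducing the same order on
  all of such a class agree there; so the test sets are required to contain every finite class they meet.
\<close>
definition saturated :: "'a topology \<Rightarrow> 'a set \<Rightarrow> bool" where
  "saturated X A \<longleftrightarrow> (\<forall>C\<in>similarity_classes X. finite C \<longrightarrow> A \<inter> C \<noteq> {} \<longrightarrow> C \<subseteq> A)"

definition order_matched ::
  "'a topology \<Rightarrow> ('a set \<Rightarrow> 'a \<times> 'a \<Rightarrow> bool) \<Rightarrow> 'a set \<Rightarrow> ('a \<Rightarrow> 'a) \<Rightarrow> ('a \<Rightarrow> 'a) \<Rightarrow> bool" where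
  "order_matched X R A g h \<longleftrightarrow> (\<forall>C\<in>similarity_classes X. \<forall>x\<in>A \<inter> C. \<forall>y\<in>A \<inter> C.
     LO_act X g R C (x, y) = LO_act X h R C (x, y))"

text \<open>It suffices to adjoin the finite classes that meet \<open>A\<close>; each is the class
  of a point of \<open>A\<close>, so there are finitely many.\<close>

lemma finite_saturated_hull:
  assumes "finite A" "A \<subseteq> topspace X"
  obtains B where "finite B" "A \<subseteq> B" "B \<subseteq> topspace X" "saturated X B"
proof -
  define F where "F = {C \<in> similarity_classes X. finite C \<and> A \<inter> C \<noteq> {}}"
  have F: "C = sim_class X x" if "C \<in> F" "x \<in> A \<inter> C" for C x
    using that similarity_class_eq[of C X x] by (simp add: F_def)
  have "F \<subseteq> sim_class X ` A"
  proof
    fix C assume C: "C \<in> F"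
    then obtain x where "x \<in> A \<inter> C" by (auto simp: F_def)
    then show "C \<in> sim_class X ` A" using F[OF C] by auto
  qed
  then have finF: "finite F" using assms(1) finite_surj by blast
  show thesis
  proof (rule that)
    show "finite (A \<union> \<Union>F)" using assms(1) finF by (auto simp: F_def)
    show "A \<subseteq> A \<union> \<Union>F" by simp
    have "C \<subseteq> topspace X" if "C \<in> F" for C using that similarity_class_subset by (auto simp: F_def)
    then show "A \<union> \<Union>F \<subseteq> topspace X" using assms(2) by auto
    show "saturated X (A \<union> \<Union>F)"
      unfolding saturated_def
    proof (intro ballI impI)
      fix C assume C: "C \<in> similarity_classes X" "finite C" "(A \<union> \<Union>F) \<inter> C \<noteq> {}"
      then obtain x where x: "x \<in> A \<union> \<Union>F" "x \<in> C" by auto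
      have "C \<in> F"
      proof (cases "x \<in> A")
        case True
        then show ?thesis using C x(2) by (auto simp: F_def)
      next
        case False
        then obtain D where D: "D \<in> F" "x \<in> D" using x(1) by auto
        then have "D = C" using similarity_class_eq[OF C(1) x(2)] similarity_class_eq[of D X x] by (simp add: F_def)
        then show ?thesis using D(1) by simp
      qed
      then show "C \<subseteq> A \<union> \<Union>F" by auto
    qed
  qed
qed

lemma bij_betw_Homeo_finite_class:
  assumes "g \<in> Homeo X" "C \<in> similarity_classes X" "finite C"
  shows "inj_on g C" "g ` C = C"
proof -
  show inj: "inj_on g C" using bij_is_inj[OF bij_Homeo[OF assms(1)]] by (meson inj_on_subset subset_UNIV)
  have "g ` C \<subseteq> C" using Homeo_similarity_class[OF assms(1,2)] by auto
  then show "g ` C = C" using endo_inj_surj[OF assms(3) _ inj] by simp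
qed

lemma order_matchedD:
  assumes "order_matched X R A g h" "g \<in> Homeo X" "h \<in> Homeo X"
    and "C \<in> similarity_classes X" "x \<in> A" "y \<in> A" "x \<in> C" "y \<in> C"
  shows "R C (inv g x, inv g y) = R C (inv h x, inv h y)"
proof -
  have "LO_act X g R C (x, y) = LO_act X h R C (x, y)"
    using assms(1,4-8) unfolding order_matched_def by blast
  then show ?thesis
    by (simp only: LO_act_apply[OF assms(2,4,7,8)] LO_act_apply[OF assms(3,4,7,8)])
qed

text \<open>Saturation puts all of \<open>C\<close> into \<open>A\<close>, so both inverses permute
  \<open>C\<close> and pull \<open>R C\<close> back to the same order; rigidity makes them
  equal.\<close>

lemma order_matched_finite_class:
  assumes R: "R \<in> topspace (prod_LO_top X)" and A: "saturated X A" "order_matched X R A g h"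
    and gh: "g \<in> Homeo X" "h \<in> Homeo X"
    and C: "C \<in> similarity_classes X" "finite C" and x: "x \<in> A \<inter> C"
  shows "inv g x = inv h x"
proof (rule finite_order_embedding_unique[OF C(2), of "\<lambda>x y. R C (x, y)" "inv g" "inv h"])
  have CA: "C \<subseteq> A" using A(1) C x unfolding saturated_def by blast
  note g' = bij_betw_Homeo_finite_class[OF Homeo_inv[OF gh(1)] C]
  note h' = bij_betw_Homeo_finite_class[OF Homeo_inv[OF gh(2)] C]
  show "strict_linear_on (\<lambda>x y. R C (x, y)) (inv g ` C)"
    unfolding g'(2) by (rule prod_LO_strict_linear_on[OF R C(1)])
  show "inv g ` C = inv h ` C" "inj_on (inv g) C" "inj_on (inv h) C" using g' h' by simp_all
  show "x \<in> C" using x by simp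
  fix s t assume "s \<in> C" "t \<in> C"
  then show "R C (inv g s, inv g t) \<longleftrightarrow> R C (inv h s, inv h t)"
    using order_matchedD[OF A(2) gh C(1)] CA by blast
qed

text \<open>Only the values of \<open>m\<close> on the finite set \<open>B\<close> matter. They are
  chosen along a Ramsey-homogeneous sequence, so that no colouring of the family distinguishes the
  two order-matched injections after composition with \<open>m\<close>.\<close>

lemma fully_transitive_Ramsey:
  fixes g h :: "'i \<Rightarrow> 'a \<Rightarrow> 'a" and col :: "'i \<Rightarrow> ('a \<Rightarrow> 'a) \<Rightarrow> bool"
  assumes ft: "fully_transitive X" and R: "R \<in> topspace (prod_LO_top X)" and I: "finite I"
    and A: "\<And>i. i \<in> I \<Longrightarrow> finite (A i)" "\<And>i. i \<in> I \<Longrightarrow> A i \<subseteq> topspace X" "\<And>i. i \<in> I \<Longrightarrow> saturated X (A i)"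
    and gh: "\<And>i. i \<in> I \<Longrightarrow> g i \<in> Homeo X" "\<And>i. i \<in> I \<Longrightarrow> h i \<in> Homeo X"
    and om: "\<And>i. i \<in> I \<Longrightarrow> order_matched X R (A i) (g i) (h i)"
    and col: "\<And>i u v. i \<in> I \<Longrightarrow> (\<And>t. t \<in> A i \<Longrightarrow> u t = v t) \<Longrightarrow> (col i u \<longleftrightarrow> col i v)"
  obtains m where "m \<in> Homeo X"
    "\<And>i. i \<in> I \<Longrightarrow> (col i (m \<circ> inv (g i)) \<longleftrightarrow> col i (m \<circ> inv (h i)))"
proof -
  let ?cl = "sim_class X"
  define B where "B = (\<Union>i\<in>I. inv (g i) ` A i \<union> inv (h i) ` A i)"
  have finB: "finite B" using I A(1) by (simp add: B_def)
  have inB: "inv (g i) t \<in> B" "inv (h i) t \<in> B" if "i \<in> I" "t \<in> A i" for i t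
    using that by (auto simp: B_def)
  have cl: "?cl (inv (g i) t) = ?cl t" "?cl (inv (h i) t) = ?cl t" "inv (g i) t \<in> topspace X" "inv (h i) t \<in> topspace X"
    if i: "i \<in> I" and t: "t \<in> A i" for i t
  proof -
    have "t \<in> topspace X" using A(2)[OF i] t by auto
    then have "inv (g i) t \<in> ?cl t" "inv (h i) t \<in> ?cl t"
      using Homeo_sim_class[OF Homeo_inv[OF gh(1)[OF i]] sim_class_self]
        Homeo_sim_class[OF Homeo_inv[OF gh(2)[OF i]] sim_class_self] by auto
    then show "?cl (inv (g i) t) = ?cl t" "?cl (inv (h i) t) = ?cl t" "inv (g i) t \<in> topspace X" "inv (h i) t \<in> topspace X"
      using sim_class_subset[of X t] by (auto simp only: sim_class_eq)
  qed
  have BT: "B \<subseteq> topspace X"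
  proof
    fix b assume "b \<in> B"
    then obtain i t where "i \<in> I" "t \<in> A i" "b = inv (g i) t \<or> b = inv (h i) t" by (auto simp: B_def)
    then show "b \<in> topspace X" using cl(3,4) by auto
  qed
  obtain num :: "'a set \<Rightarrow> nat" where num: "inj_on num (?cl ` B)"
    using finite_imp_inj_to_nat_seg[of "?cl ` B"] finB by blast
  \<comment> \<open>\<open>L\<close> lists the points of \<open>B\<close> class by class, following \<open>R\<close> inside each class. Moving the
    \<open>k\<close>-th point of \<open>B\<close> to the \<open>(\<eta> k)\<close>-th term of a sequence \<open>\<xi>\<close> in its class turns colourings of
    injections into \<open>X\<close> into colourings of finite sets of natural numbers, so that one application of
    Ramsey's theorem handles all classes at once.\<close>
  define L where "L = (\<lambda>x y. num (?cl x) < num (?cl y) \<or> ?cl x = ?cl y \<and> R (?cl x) (x, y))"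
  have R_cl: "strict_linear_on (\<lambda>x y. R (?cl b) (x, y)) (?cl b)" if "b \<in> B" for b
    using prod_LO_strict_linear_on[OF R, of "?cl b"] that BT by (auto simp: similarity_classes_eq)
  have self: "b \<in> ?cl b" if "b \<in> B" for b using that BT by (blast intro: sim_class_self)
  have L: "strict_linear_on L B"
    unfolding strict_linear_on_def
  proof (intro conjI ballI impI)
    fix x assume x: "x \<in> B"
    show "\<not> L x x" using strict_linear_onD(1)[OF R_cl[OF x] self[OF x]] by (simp add: L_def)
  next
    fix x y z assume B: "x \<in> B" "y \<in> B" "z \<in> B" and xy: "L x y" and yz: "L y z"
    show "L x z"
    proof (cases "?cl x = ?cl y \<and> ?cl y = ?cl z")
      case True
      have "y \<in> ?cl x" "z \<in> ?cl x" using True self[OF B(2)] self[OF B(3)] by simp_all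
      then show ?thesis
        using strict_linear_onD(2)[OF R_cl[OF B(1)] self[OF B(1)], of y z] True xy yz by (simp add: L_def)
    next
      case False
      moreover have "num (?cl x) < num (?cl y) \<or> ?cl x = ?cl y" "num (?cl y) < num (?cl z) \<or> ?cl y = ?cl z"
        using xy yz unfolding L_def by argo+
      ultimately have "num (?cl x) < num (?cl z)" by (metis less_trans)
      then show ?thesis by (simp add: L_def)
    qed
  next
    fix x y assume B: "x \<in> B" "y \<in> B" and ne: "x \<noteq> y"
    show "L x y \<or> L y x"
    proof (cases "?cl x = ?cl y")
      case True
      then have "y \<in> ?cl x" using self[OF B(2)] by simp
      then show ?thesis
        using strict_linear_onD(3)[OF R_cl[OF B(1)] self[OF B(1)] _ ne] True by (auto simp: L_def)
    next
      case False
      then have "num (?cl x) \<noteq> num (?cl y)" using inj_onD[OF num, of "?cl x" "?cl y"] B by auto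
      then show ?thesis by (auto simp: L_def)
    qed
  qed
  define pos where "pos = order_rank L B"
  have pos: "pos x < pos y \<longleftrightarrow> L x y" if "x \<in> B" "y \<in> B" for x y
    unfolding pos_def by (rule order_rank_less_iff[OF finB L that])
  have inj_pos: "inj_on pos B" unfolding pos_def by (rule inj_on_order_rank[OF finB L])
  define \<xi> where "\<xi> = (\<lambda>C. SOME f :: nat \<Rightarrow> 'a. inj f \<and> range f \<subseteq> C)"
  have \<xi>: "inj (\<xi> C) \<and> range (\<xi> C) \<subseteq> C" if "infinite C" for C
    unfolding \<xi>_def by (rule someI_ex[OF infinite_countable_subset[OF that]])
  \<comment> \<open>A finite class leaves no room for a sequence, so its points stay fixed.\<close>
  define w where "w = (\<lambda>b n. if finite (?cl b) then b else \<xi> (?cl b) n)"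
  have w_class: "w b n \<in> ?cl b" if "b \<in> B" for b n
    using \<xi>[of "?cl b"] self[OF that] by (auto simp: w_def)
  \<comment> \<open>In an infinite class \<open>w\<close> sees only the class, which both inverses
    preserve; in a finite class the two points coincide. The colourings below can therefore be
    written with \<open>g\<close> alone.\<close>
  have w_eq: "w (inv (g i) t) = w (inv (h i) t)" if i: "i \<in> I" and t: "t \<in> A i" for i t
  proof (cases "finite (?cl t)")
    case True
    have "?cl t \<in> similarity_classes X" "t \<in> A i \<inter> ?cl t"
      using t A(2)[OF i] by (auto simp: similarity_classes_eq sim_class_self subset_iff)
    then have "inv (g i) t = inv (h i) t"
      using order_matched_finite_class[OF R A(3)[OF i] om[OF i] gh(1)[OF i] gh(2)[OF i]] True by metis
    then show ?thesis by simp
  next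
    case False
    then show ?thesis by (intro ext) (simp add: w_def cl[OF i t])
  qed
  obtain \<eta> :: "nat \<Rightarrow> nat" where \<eta>: "strict_mono \<eta>"
    and hom: "\<And>i. i \<in> I \<Longrightarrow> (col i (\<lambda>t. w (inv (g i) t) ((\<eta> \<circ> (\<lambda>t. pos (inv (g i) t))) t)) \<longleftrightarrow>
        col i (\<lambda>t. w (inv (g i) t) ((\<eta> \<circ> (\<lambda>t. pos (inv (h i) t))) t)))"
  proof (rule Ramsey_order_type_finite_family[OF I, of A "\<lambda>i t. pos (inv (g i) t)" "\<lambda>i t. pos (inv (h i) t)"
        "\<lambda>i n. col i (\<lambda>t. w (inv (g i) t) (n t))"])
    fix i assume i: "i \<in> I"
    show "finite (A i)" by (rule A(1)[OF i])
    show "inj_on (\<lambda>t. pos (inv (g i) t)) (A i)"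
    proof (rule inj_onI)
      fix s t assume st: "s \<in> A i" "t \<in> A i" "pos (inv (g i) s) = pos (inv (g i) t)"
      then have "inv (g i) s = inv (g i) t" using inj_onD[OF inj_pos] inB(1)[OF i] by blast
      then show "s = t" using bij_Homeo[OF Homeo_inv[OF gh(1)[OF i]]] by (meson bij_is_inj injD)
    qed
    show "inj_on (\<lambda>t. pos (inv (h i) t)) (A i)"
    proof (rule inj_onI)
      fix s t assume st: "s \<in> A i" "t \<in> A i" "pos (inv (h i) s) = pos (inv (h i) t)"
      then have "inv (h i) s = inv (h i) t" using inj_onD[OF inj_pos] inB(2)[OF i] by blast
      then show "s = t" using bij_Homeo[OF Homeo_inv[OF gh(2)[OF i]]] by (meson bij_is_inj injD)
    qed
    \<comment> \<open>Points of different classes are compared through \<open>num\<close>, which the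
      inverses do not affect; points of the same class are compared through \<open>R\<close>, where
      \<open>order_matched\<close> applies.\<close>
    show "pos (inv (g i) s) < pos (inv (g i) t) \<longleftrightarrow> pos (inv (h i) s) < pos (inv (h i) t)"
      if st: "s \<in> A i" "t \<in> A i" for s t
    proof -
      have "R (?cl s) (inv (g i) s, inv (g i) t) = R (?cl s) (inv (h i) s, inv (h i) t)" if "?cl s = ?cl t"
      proof -
        have "s \<in> topspace X" "t \<in> topspace X" using st A(2)[OF i] by auto
        then have C: "?cl s \<in> similarity_classes X" and "s \<in> ?cl s" "t \<in> ?cl s"
          using that sim_class_self[of s X] sim_class_self[of t X] by (simp_all add: similarity_classes_eq)
        then show ?thesis using order_matchedD[OF om[OF i] gh(1)[OF i] gh(2)[OF i]] st by simp
      qed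
      then show ?thesis
        using pos[OF inB(1)[OF i st(1)] inB(1)[OF i st(2)]] pos[OF inB(2)[OF i st(1)] inB(2)[OF i st(2)]]
        by (auto simp: L_def cl[OF i st(1)] cl[OF i st(2)])
    qed
    show "col i (\<lambda>t. w (inv (g i) t) (u t)) \<longleftrightarrow> col i (\<lambda>t. w (inv (g i) t) (v t))"
      if "\<And>t. t \<in> A i \<Longrightarrow> u t = v t" for u v
      by (rule col[OF i]) (simp add: that)
  next
    fix \<eta> :: "nat \<Rightarrow> nat" assume "strict_mono \<eta>"
      "\<And>i. i \<in> I \<Longrightarrow> (col i (\<lambda>t. w (inv (g i) t) ((\<eta> \<circ> (\<lambda>t. pos (inv (g i) t))) t)) \<longleftrightarrow>
        col i (\<lambda>t. w (inv (g i) t) ((\<eta> \<circ> (\<lambda>t. pos (inv (h i) t))) t)))"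
    then show thesis by (rule that)
  qed
  have inj: "inj_on (\<lambda>b. w b (\<eta> (pos b))) B"
  proof (rule inj_onI)
    fix x y assume B: "x \<in> B" "y \<in> B" and eq: "w x (\<eta> (pos x)) = w y (\<eta> (pos y))"
    have clxy: "?cl x = ?cl y"
      using sim_class_eq[OF w_class[OF B(1)]] sim_class_eq[OF w_class[OF B(2)]] eq by metis
    show "x = y"
    proof (cases "finite (?cl x)")
      case True
      then show ?thesis using eq clxy by (simp add: w_def)
    next
      case False
      then have "\<xi> (?cl x) (\<eta> (pos x)) = \<xi> (?cl x) (\<eta> (pos y))" using eq clxy by (simp add: w_def)
      then have "pos x = pos y"
        using \<xi>[OF False] strict_mono_eq[OF \<eta>] by (auto dest: injD)
      then show ?thesis using inj_onD[OF inj_pos _ B] by simp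
    qed
  qed
  obtain m where m: "m \<in> Homeo X" "\<And>b. b \<in> B \<Longrightarrow> m b = w b (\<eta> (pos b))"
    by (rule fully_transitive_extend[OF ft finB BT inj w_class]) blast+
  show thesis
  proof (rule that[OF m(1)])
    fix i assume i: "i \<in> I"
    have "col i (m \<circ> inv (g i)) \<longleftrightarrow> col i (\<lambda>t. w (inv (g i) t) ((\<eta> \<circ> (\<lambda>t. pos (inv (g i) t))) t))"
      by (rule col[OF i]) (simp add: m(2) inB(1)[OF i])
    also have "\<dots> \<longleftrightarrow> col i (\<lambda>t. w (inv (g i) t) ((\<eta> \<circ> (\<lambda>t. pos (inv (h i) t))) t))"
      by (rule hom[OF i])
    also have "\<dots> \<longleftrightarrow> col i (m \<circ> inv (h i))"
      by (rule col[OF i]) (simp add: m(2) inB(2)[OF i] w_eq[OF i])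
    finally show "col i (m \<circ> inv (g i)) \<longleftrightarrow> col i (m \<circ> inv (h i))" .
  qed
qed

subsection \<open>Universality\<close>

text \<open>The requirement on \<open>y\<close> for the map from \<open>g R\<close> to
  \<open>g y\<close> to be well defined. Since \<open>U\<close> and \<open>V\<close> are open, each
  instance excludes an open set of \<open>y\<close>; since separation is asked of their closures, it
  can be tested with a colouring by closed sets.\<close>

definition order_good ::
  "'a topology \<Rightarrow> ('a set \<Rightarrow> 'a \<times> 'a \<Rightarrow> bool) \<Rightarrow> 'b topology \<Rightarrow> (('a \<Rightarrow> 'a) \<Rightarrow> 'b \<Rightarrow> 'b) \<Rightarrow> 'b \<Rightarrow> bool" where
  "order_good X R Y act y \<longleftrightarrow> (\<forall>U V A g h.
     openin Y U \<longrightarrow> openin Y V \<longrightarrow> finite A \<longrightarrow> A \<subseteq> topspace X \<longrightarrow> saturated X A \<longrightarrow>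
     g \<in> Homeo X \<longrightarrow> h \<in> Homeo X \<longrightarrow> order_matched X R A g h \<longrightarrow>
     (\<forall>v\<in>Homeo X. (\<forall>a\<in>A. v a = a) \<longrightarrow> (\<forall>z\<in>Y closure_of U. act v z \<notin> Y closure_of V)) \<longrightarrow>
     \<not> (act g y \<in> U \<and> act h y \<in> V))"

text \<open>Each constraint defines a closed set, and any finitely many of them are met by one
  translate of an arbitrary \<open>y0\<close>; compactness gives a point meeting all of
  them.\<close>

lemma exists_order_good:
  assumes ft: "fully_transitive X" and ne: "topspace X \<noteq> {}" and R: "R \<in> topspace (prod_LO_top X)"
    and Y: "is_flow (Homeo_top X) Y act"
  obtains y where "y \<in> topspace Y" "order_good X R Y act y"
proof -
  have TG: "topspace (Homeo_top X) = Homeo X" by (rule topspace_Homeo_top[OF ne])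
  have cY: "compact_space Y" and act_in: "\<And>g y. g \<in> Homeo X \<Longrightarrow> y \<in> topspace Y \<Longrightarrow> act g y \<in> topspace Y"
    and act_comp: "\<And>g h y. g \<in> Homeo X \<Longrightarrow> h \<in> Homeo X \<Longrightarrow> y \<in> topspace Y \<Longrightarrow> act (g \<circ> h) y = act g (act h y)"
    using Y by (simp_all add: is_flow_def TG)
  obtain y0 where y0: "y0 \<in> topspace Y" by (rule flow_point[OF Y])
  define adm where "adm = {(U, V, A, g, h). openin Y U \<and> openin Y V \<and> finite A \<and> A \<subseteq> topspace X \<and> saturated X A \<and>
     g \<in> Homeo X \<and> h \<in> Homeo X \<and> order_matched X R A g h \<and>
     (\<forall>v\<in>Homeo X. (\<forall>a\<in>A. v a = a) \<longrightarrow> (\<forall>z\<in>Y closure_of U. act v z \<notin> Y closure_of V))}"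
  define F where "F = (\<lambda>(U, V, A :: 'a set, g, h). topspace Y - ({y \<in> topspace Y. act g y \<in> U} \<inter> {y \<in> topspace Y. act h y \<in> V}))"
  have closed: "closedin Y (F c)" if "c \<in> adm" for c
  proof -
    obtain U V A g h where c: "c = (U, V, A, g, h)" by (cases c) auto
    have "openin Y U" "openin Y V" "g \<in> Homeo X" "h \<in> Homeo X" using that by (simp_all add: c adm_def)
    then show ?thesis
      unfolding c F_def prod.case
      by (intro closedin_diff closedin_topspace openin_Int openin_continuous_map_preimage[OF flow_continuous_map_act[OF Y]])
        (simp_all add: TG)
  qed
  have fin: "\<exists>k\<in>Homeo X. \<forall>c\<in>I. act k y0 \<in> F c" if I: "finite I" "I \<subseteq> adm" for I
  proof -
    define U V A g h where "U = (\<lambda>c :: 'b set \<times> 'b set \<times> 'a set \<times> ('a \<Rightarrow> 'a) \<times> ('a \<Rightarrow> 'a). fst c)"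
      and "V = (\<lambda>c :: 'b set \<times> 'b set \<times> 'a set \<times> ('a \<Rightarrow> 'a) \<times> ('a \<Rightarrow> 'a). fst (snd c))"
      and "A = (\<lambda>c :: 'b set \<times> 'b set \<times> 'a set \<times> ('a \<Rightarrow> 'a) \<times> ('a \<Rightarrow> 'a). fst (snd (snd c)))"
      and "g = (\<lambda>c :: 'b set \<times> 'b set \<times> 'a set \<times> ('a \<Rightarrow> 'a) \<times> ('a \<Rightarrow> 'a). fst (snd (snd (snd c))))"
      and "h = (\<lambda>c :: 'b set \<times> 'b set \<times> 'a set \<times> ('a \<Rightarrow> 'a) \<times> ('a \<Rightarrow> 'a). snd (snd (snd (snd c))))"
    have c_eq: "c = (U c, V c, A c, g c, h c)" for c by (simp add: U_def V_def A_def g_def h_def)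
    have adm: "openin Y (U c)" "openin Y (V c)" "finite (A c)" "A c \<subseteq> topspace X" "saturated X (A c)"
      "g c \<in> Homeo X" "h c \<in> Homeo X" "order_matched X R (A c) (g c) (h c)"
      "\<And>v z. v \<in> Homeo X \<Longrightarrow> (\<And>a. a \<in> A c \<Longrightarrow> v a = a) \<Longrightarrow> z \<in> Y closure_of U c \<Longrightarrow> act v z \<notin> Y closure_of V c"
      if "c \<in> I" for c
    proof -
      have "(U c, V c, A c, g c, h c) \<in> adm" using that I(2) c_eq[of c] by auto
      then have *: "openin Y (U c) \<and> openin Y (V c) \<and> finite (A c) \<and> A c \<subseteq> topspace X \<and> saturated X (A c) \<and>
        g c \<in> Homeo X \<and> h c \<in> Homeo X \<and> order_matched X R (A c) (g c) (h c) \<and>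
        (\<forall>v\<in>Homeo X. (\<forall>a\<in>A c. v a = a) \<longrightarrow> (\<forall>z\<in>Y closure_of U c. act v z \<notin> Y closure_of V c))"
        unfolding adm_def mem_Collect_eq prod.case .
      then show "openin Y (U c)" "openin Y (V c)" "finite (A c)" "A c \<subseteq> topspace X" "saturated X (A c)"
        "g c \<in> Homeo X" "h c \<in> Homeo X" "order_matched X R (A c) (g c) (h c)" by simp_all
      show "act v z \<notin> Y closure_of V c"
        if "v \<in> Homeo X" "\<And>a. a \<in> A c \<Longrightarrow> v a = a" "z \<in> Y closure_of U c" for v z
        using * that by simp
    qed
    \<comment> \<open>By the separation property of \<open>A c\<close>, \<open>q y0\<close> cannot lie in the closure of \<open>U c\<close> for one \<open>q\<close> and in
      that of \<open>V c\<close> for another \<open>q\<close> whose inverse has the same restriction to \<open>A c\<close>.\<close>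
    define col where "col = (\<lambda>c e. \<exists>q\<in>Homeo X. (\<forall>t\<in>A c. inv q t = e t) \<and> act q y0 \<in> Y closure_of U c)"
    have col: "col c u \<longleftrightarrow> col c v" if "\<And>t. t \<in> A c \<Longrightarrow> u t = v t" for c u v
      unfolding col_def using that by (simp cong: ball_cong)
    obtain m where m: "m \<in> Homeo X"
      and eq: "\<And>c. c \<in> I \<Longrightarrow> (col c (m \<circ> inv (g c)) \<longleftrightarrow> col c (m \<circ> inv (h c)))"
    proof (rule fully_transitive_Ramsey[OF ft R I(1) adm(3,4,5,6,7,8), where col = col])
      show "col c u \<longleftrightarrow> col c v" if "\<And>t. t \<in> A c \<Longrightarrow> u t = v t" for c u v
        using that by (rule col)
    qed (assumption | rule that)+
    \<comment> \<open>With this choice \<open>inv (f \<circ> k) = m \<circ> inv f\<close>, so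
      colours of injections composed with \<open>m\<close> speak of translates of
      \<open>act k y0\<close>.\<close>
    define k where "k = inv m"
    have k: "k \<in> Homeo X" unfolding k_def by (rule Homeo_inv[OF m])
    have inv_k: "inv (f \<circ> k) = m \<circ> inv f" if "f \<in> Homeo X" for f
      using o_inv_distrib[OF bij_Homeo[OF that] bij_Homeo[OF k]] inv_inv_eq[OF bij_Homeo[OF m]]
      by (simp add: k_def)
    have "act k y0 \<in> F c" if c: "c \<in> I" for c
    proof (rule ccontr)
      assume "act k y0 \<notin> F c"
      then have "act k y0 \<notin> F (U c, V c, A c, g c, h c)" using c_eq by metis
      then have UV: "act (g c) (act k y0) \<in> U c" "act (h c) (act k y0) \<in> V c"
        using act_in[OF k y0] by (simp_all add: F_def)
      have gk: "g c \<circ> k \<in> Homeo X" "h c \<circ> k \<in> Homeo X" using Homeo_comp adm(6,7)[OF c] k by blast+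
      have U': "act (g c \<circ> k) y0 \<in> Y closure_of U c"
        using UV(1) act_comp[OF adm(6)[OF c] k y0] closure_of_subset[OF openin_subset[OF adm(1)[OF c]]] by auto
      have V': "act (h c \<circ> k) y0 \<in> Y closure_of V c"
        using UV(2) act_comp[OF adm(7)[OF c] k y0] closure_of_subset[OF openin_subset[OF adm(2)[OF c]]] by auto
      have "col c (m \<circ> inv (g c))"
        unfolding col_def using gk(1) U' inv_k[OF adm(6)[OF c]] by (intro bexI[of _ "g c \<circ> k"]) simp_all
      then obtain q where q: "q \<in> Homeo X" "\<And>t. t \<in> A c \<Longrightarrow> inv q t = m (inv (h c) t)" "act q y0 \<in> Y closure_of U c"
        using eq[OF c] by (auto simp: col_def)
      \<comment> \<open>Since \<open>q\<close> and \<open>h c \<circ> k\<close> have inverses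
        agreeing on \<open>A c\<close>, their quotient \<open>v\<close> fixes \<open>A c\<close>
        pointwise. It takes a point of the closure of \<open>U c\<close> into that of
        \<open>V c\<close>, against admissibility.\<close>
      define v where "v = (h c \<circ> k) \<circ> inv q"
      have v: "v \<in> Homeo X" unfolding v_def by (rule Homeo_comp[OF gk(2) Homeo_inv[OF q(1)]])
      have v_stab: "v a = a" if "a \<in> A c" for a
      proof -
        have "inv q a = inv (h c \<circ> k) a" using q(2)[OF that] inv_k[OF adm(7)[OF c]] by simp
        then have "v a = (h c \<circ> k) (inv (h c \<circ> k) a)" by (simp add: v_def)
        also have "\<dots> = a" by (rule surj_f_inv_f[OF bij_is_surj[OF bij_Homeo[OF gk(2)]]])
        finally show ?thesis .
      qed
      have "v \<circ> q = h c \<circ> k"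
        unfolding v_def using bij_is_inj[OF bij_Homeo[OF q(1)]] by (simp add: comp_assoc)
      then have "act v (act q y0) = act (h c \<circ> k) y0" using act_comp[OF v q(1) y0] by simp
      then show False using adm(9)[OF c v v_stab q(3)] V' by simp
    qed
    then show ?thesis using k by blast
  qed
  \<comment> \<open>Inserting \<open>topspace Y\<close> keeps the intersection inside
    \<open>Y\<close> even if there are no constraints.\<close>
  have "\<Inter>(insert (topspace Y) (F ` adm)) \<noteq> {}"
  proof (rule cY[unfolded compact_space_fip, THEN spec, THEN mp], intro conjI ballI allI impI)
    show "closedin Y D" if "D \<in> insert (topspace Y) (F ` adm)" for D
      using that closed by auto
    fix \<F> assume "finite \<F> \<and> \<F> \<subseteq> insert (topspace Y) (F ` adm)"
    then have "finite (\<F> - {topspace Y})" "\<F> - {topspace Y} \<subseteq> F ` adm" by auto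
    then obtain I where I: "finite I" "I \<subseteq> adm" "\<F> - {topspace Y} = F ` I"
      using finite_subset_image by meson
    obtain k where k: "k \<in> Homeo X" "\<forall>c\<in>I. act k y0 \<in> F c" using fin[OF I(1,2)] by blast
    have "act k y0 \<in> D" if "D \<in> \<F>" for D
    proof (cases "D = topspace Y")
      case True
      then show ?thesis using act_in[OF k(1) y0] by simp
    next
      case False
      then have "D \<in> F ` I" using that I(3) by blast
      then show ?thesis using k(2) by auto
    qed
    then show "\<Inter>\<F> \<noteq> {}" by blast
  qed
  then obtain y where y: "y \<in> topspace Y" "\<And>c. c \<in> adm \<Longrightarrow> y \<in> F c" by auto
  have "order_good X R Y act y"
    unfolding order_good_def
  proof (intro allI impI)
    fix U V A g h
    assume a: "openin Y U" "openin Y V" "finite A" "A \<subseteq> topspace X" "saturated X A" "g \<in> Homeo X" "h \<in> Homeo X"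
      "order_matched X R A g h"
      "\<forall>v\<in>Homeo X. (\<forall>a\<in>A. v a = a) \<longrightarrow> (\<forall>z\<in>Y closure_of U. act v z \<notin> Y closure_of V)"
    have "(U, V, A, g, h) \<in> adm" unfolding adm_def mem_Collect_eq prod.case using a by (intro conjI)
    then have "y \<in> F (U, V, A, g, h)" by (rule y(2))
    then show "\<not> (act g y \<in> U \<and> act h y \<in> V)" using y(1) by (simp add: F_def)
  qed
  then show thesis using that y(1) by blast
qed

text \<open>A finite intersection of coordinate conditions: only pairs of points of \<open>A\<close>
  in a common class contribute, and such a pair determines its class.\<close>

lemma openin_prod_LO_finite:
  assumes "finite A" "R \<in> topspace (prod_LO_top X)"
  shows "openin (prod_LO_top X) {S \<in> topspace (prod_LO_top X).
    \<forall>C\<in>similarity_classes X. \<forall>x\<in>A \<inter> C. \<forall>y\<in>A \<inter> C. S C (x, y) = R C (x, y)}"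
proof -
  let ?P = "prod_LO_top X"
  define N where "N = (\<lambda>(x, y). {S \<in> topspace ?P. S (sim_class X x) (x, y) = R (sim_class X x) (x, y)})"
  define I where "I = {(x, y). x \<in> A \<and> y \<in> A \<and> (\<exists>C\<in>similarity_classes X. x \<in> C \<and> y \<in> C)}"
  have "I \<subseteq> A \<times> A" by (auto simp: I_def)
  then have "finite I" using assms(1) by (meson finite_SigmaI finite_subset)
  moreover have "openin ?P (N p)" if p: "p \<in> I" for p
  proof -
    obtain x y C where "p = (x, y)" "C \<in> similarity_classes X" "x \<in> C" "y \<in> C" using p by (auto simp: I_def)
    then show ?thesis using openin_prod_LO_eval[of C X x y] similarity_class_eq[of C X x] by (simp add: N_def)
  qed
  ultimately have "openin ?P (topspace ?P \<inter> \<Inter>(N ` I))"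
    by (cases "I = {}") (auto intro!: openin_Int openin_Inter)
  moreover have "topspace ?P \<inter> \<Inter>(N ` I) = {S \<in> topspace ?P.
    \<forall>C\<in>similarity_classes X. \<forall>x\<in>A \<inter> C. \<forall>y\<in>A \<inter> C. S C (x, y) = R C (x, y)}" (is "?l = ?r")
  proof
    show "?l \<subseteq> ?r"
    proof
      fix S assume S: "S \<in> ?l"
      have "S C (x, y) = R C (x, y)" if "C \<in> similarity_classes X" "x \<in> A \<inter> C" "y \<in> A \<inter> C" for C x y
      proof -
        have "(x, y) \<in> I" using that by (auto simp: I_def)
        then have "S \<in> N (x, y)" using S by blast
        then show ?thesis using similarity_class_eq[of C X x] that by (simp add: N_def)
      qed
      then show "S \<in> ?r" using S by simp
    qed
    show "?r \<subseteq> ?l"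
    proof
      fix S assume S: "S \<in> ?r"
      have "S \<in> N p" if p: "p \<in> I" for p
      proof -
        obtain x y C where "p = (x, y)" "C \<in> similarity_classes X" "x \<in> A \<inter> C" "y \<in> A \<inter> C"
          using p by (auto simp: I_def)
        then show ?thesis using S similarity_class_eq[of C X x] by (simp add: N_def)
      qed
      then show "S \<in> ?l" using S by simp
    qed
  qed
  ultimately show ?thesis by simp
qed

lemma flow_maps_onto_prod_LO:
  assumes sc: "scattered_space X" and ft: "fully_transitive X" and ne: "topspace X \<noteq> {}"
    and Y: "is_minimal_flow (Homeo_top X) Y act"
  shows "flow_maps_onto (Homeo_top X) (prod_LO_top X) (LO_act X) Y act"
proof -
  let ?P = "prod_LO_top X" and ?G = "Homeo_top X"
  let ?T = "prod_topology ?P Y"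
  have TG: "topspace ?G = Homeo X" by (rule topspace_Homeo_top[OF ne])
  have fY: "is_flow ?G Y act" using Y by (simp add: is_minimal_flow_def)
  have fP: "is_flow ?G ?P (LO_act X)" by (rule is_flow_prod_LO[OF sc])
  have YY: "compact_space Y" "Hausdorff_space Y"
    and act_in: "\<And>g y. g \<in> Homeo X \<Longrightarrow> y \<in> topspace Y \<Longrightarrow> act g y \<in> topspace Y"
    and act_comp: "\<And>g h y. g \<in> Homeo X \<Longrightarrow> h \<in> Homeo X \<Longrightarrow> y \<in> topspace Y \<Longrightarrow> act (g \<circ> h) y = act g (act h y)"
    using fY by (simp_all add: is_flow_def TG)
  have LO_comp: "\<And>g h R. g \<in> Homeo X \<Longrightarrow> h \<in> Homeo X \<Longrightarrow> R \<in> topspace ?P \<Longrightarrow> LO_act X (g \<circ> h) R = LO_act X g (LO_act X h R)"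
    using fP by (simp add: is_flow_def TG)
  obtain R where R: "R \<in> topspace ?P" by (rule flow_point[OF fP])
  obtain y where y: "y \<in> topspace Y" "order_good X R Y act y"
    by (rule exists_order_good[OF ft ne R fY])
  \<comment> \<open>The orbit of the pair of \<open>R\<close> and \<open>y\<close> in the product
    flow; its closure is invariant because every homeomorphism acts continuously.\<close>
  define D where "D = (\<lambda>g. (LO_act X g R, act g y)) ` Homeo X"
  have DT: "D \<subseteq> topspace ?T" using LO_act_topspace[OF _ R] act_in[OF _ y(1)] by (auto simp: D_def)
  show ?thesis
  proof (rule flow_maps_onto_of_graph[OF is_minimal_flow_prod_LO[OF sc ft] Y])
    show "closedin ?T (?T closure_of D)" by simp
    have "D \<noteq> {}" using Homeo_id by (auto simp: D_def)
    then show "?T closure_of D \<noteq> {}" using closure_of_subset[OF DT] by auto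
  next
    fix g S z assume "g \<in> topspace ?G" and Sz: "(S, z) \<in> ?T closure_of D"
    then have g: "g \<in> topspace ?G" "g \<in> Homeo X" by (simp_all add: TG)
    let ?f = "\<lambda>p. (LO_act X g (fst p), act g (snd p))"
    have "continuous_map ?T ?T ?f"
      unfolding continuous_map_pairwise comp_def fst_conv snd_conv
    proof
      show "continuous_map ?T ?P (\<lambda>p. LO_act X g (fst p))"
        by (rule continuous_map_compose[OF continuous_map_fst flow_continuous_map_act[OF fP g(1)], unfolded comp_def])
      show "continuous_map ?T Y (\<lambda>p. act g (snd p))"
        by (rule continuous_map_compose[OF continuous_map_snd flow_continuous_map_act[OF fY g(1)], unfolded comp_def])
    qed
    from continuous_map_image_closure_subset[OF this]
    have "?f ` (?T closure_of D) \<subseteq> ?T closure_of (?f ` D)" .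
    moreover have "?f ` D \<subseteq> D"
    proof
      fix p assume "p \<in> ?f ` D"
      then obtain h where h: "h \<in> Homeo X" "p = (LO_act X g (LO_act X h R), act g (act h y))"
        by (auto simp: D_def)
      then have "p = (LO_act X (g \<circ> h) R, act (g \<circ> h) y)" using LO_comp[OF g(2) h(1) R] act_comp[OF g(2) h(1) y(1)] by simp
      then show "p \<in> D" unfolding D_def using Homeo_comp[OF g(2) h(1)] by blast
    qed
    ultimately have "?f ` (?T closure_of D) \<subseteq> ?T closure_of D" using closure_of_mono by blast
    then have "?f (S, z) \<in> ?T closure_of D" using Sz by blast
    then show "(LO_act X g S, act g z) \<in> ?T closure_of D" by simp
  next
    fix S z z' assume z: "(S, z) \<in> ?T closure_of D" and z': "(S, z') \<in> ?T closure_of D"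
    have T: "S \<in> topspace ?P" "z \<in> topspace Y" "z' \<in> topspace Y"
      using z z' by (auto simp: in_closure_of)
    show "z = z'"
    proof (rule ccontr)
      assume "z \<noteq> z'"
      \<comment> \<open>Disjoint open sets would not do, since \<open>order_good\<close> speaks of
        closures; regularity of \<open>Y\<close> provides disjoint closed neighbourhoods.\<close>
      obtain K L where KL: "closedin Y K" "closedin Y L" "K \<inter> L = {}"
        and UV: "\<exists>U. openin Y U \<and> z \<in> U \<and> U \<subseteq> K" "\<exists>V. openin Y V \<and> z' \<in> V \<and> V \<subseteq> L"
      proof -
        obtain U0 V0 where 0: "openin Y U0" "openin Y V0" "z \<in> U0" "z' \<in> V0" "disjnt U0 V0"
          using YY(2) T(2,3) \<open>z \<noteq> z'\<close> unfolding Hausdorff_space_def by meson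
        have nb: "neighbourhood_base_of (closedin Y) Y"
          using compact_Hausdorff_imp_regular_space[OF YY] by (simp add: neighbourhood_base_of_closedin)
        obtain U K where "openin Y U" "closedin Y K" "z \<in> U" "U \<subseteq> K" "K \<subseteq> U0"
          using nb 0(1,3) unfolding neighbourhood_base_of by meson
        moreover obtain V L where "openin Y V" "closedin Y L" "z' \<in> V" "V \<subseteq> L" "L \<subseteq> V0"
          using nb 0(2,4) unfolding neighbourhood_base_of by meson
        ultimately show thesis using that[of K L] 0(5) unfolding disjnt_def by blast
      qed
      obtain U V where U: "openin Y U" "z \<in> U" "U \<subseteq> K" and V: "openin Y V" "z' \<in> V" "V \<subseteq> L"
        using UV by blast
      have clU: "Y closure_of U \<subseteq> K" "Y closure_of V \<subseteq> L"
        using closure_of_minimal[OF U(3) KL(1)] closure_of_minimal[OF V(3) KL(2)] .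
      obtain A0 where A0: "finite A0" "A0 \<subseteq> topspace X"
        "\<And>v z. v \<in> Homeo X \<Longrightarrow> (\<And>a. a \<in> A0 \<Longrightarrow> v a = a) \<Longrightarrow> z \<in> K \<Longrightarrow> act v z \<notin> L"
        using Homeo_flow_stabilizer_separation[OF ne fY KL] by blast
      \<comment> \<open>Enlarging \<open>A0\<close> shrinks its pointwise stabiliser, so the
        separation persists for \<open>A\<close>.\<close>
      obtain A where A: "finite A" "A0 \<subseteq> A" "A \<subseteq> topspace X" "saturated X A"
        using finite_saturated_hull[OF A0(1,2)] by blast
      define M where "M = {S' \<in> topspace ?P.
        \<forall>C\<in>similarity_classes X. \<forall>x\<in>A \<inter> C. \<forall>y\<in>A \<inter> C. S' C (x, y) = S C (x, y)}"
      have M: "openin ?P M" "S \<in> M" unfolding M_def using openin_prod_LO_finite[OF A(1) T(1)] T(1) by simp_all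
      have approx: "\<exists>g\<in>Homeo X. LO_act X g R \<in> M \<and> act g y \<in> W" if w: "(S, w) \<in> ?T closure_of D" "openin Y W" "w \<in> W" for w W
      proof -
        have "openin ?T (M \<times> W)" "(S, w) \<in> M \<times> W" using M w(2,3) by (simp_all add: openin_prod_Times_iff)
        then have "\<exists>p. p \<in> D \<and> p \<in> M \<times> W"
          using w(1)[unfolded in_closure_of, THEN conjunct2, THEN spec, of "M \<times> W"] by simp
        then obtain g where "g \<in> Homeo X" "(LO_act X g R, act g y) \<in> M \<times> W" by (auto simp only: D_def)
        then show ?thesis by auto
      qed
      \<comment> \<open>Both \<open>g R\<close> and \<open>h R\<close> agree with the same
        \<open>S\<close> on \<open>A\<close>, so \<open>g\<close> and \<open>h\<close> are
        order-matched although \<open>g y\<close> and \<open>h y\<close> lie in separated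
        sets.\<close>
      obtain g where g: "g \<in> Homeo X" "LO_act X g R \<in> M" "act g y \<in> U" using approx[OF z U(1,2)] by blast
      obtain h where h: "h \<in> Homeo X" "LO_act X h R \<in> M" "act h y \<in> V" using approx[OF z' V(1,2)] by blast
      have "order_matched X R A g h"
        using g(2) h(2) unfolding order_matched_def M_def by simp
      moreover have "\<forall>v\<in>Homeo X. (\<forall>a\<in>A. v a = a) \<longrightarrow> (\<forall>z\<in>Y closure_of U. act v z \<notin> Y closure_of V)"
      proof (intro ballI impI notI)
        fix v z assume "v \<in> Homeo X" "\<forall>a\<in>A. v a = a" "z \<in> Y closure_of U" "act v z \<in> Y closure_of V"
        then show False using A0(3)[of v z] A(2) clU by blast
      qed
      ultimately have "\<not> (act g y \<in> U \<and> act h y \<in> V)"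
        using y(2) U(1) V(1) A(1,3,4) g(1) h(1) unfolding order_good_def by simp
      then show False using g(3) h(3) by simp
    qed
  qed
qed

theorem theorem15:
  fixes X :: "'a topology"
  assumes "scattered_space X"
    and "fully_transitive X"
  shows "is_minimal_flow (Homeo_top X) (prod_LO_top X) (LO_act X)
       \<and> (\<forall>(Y :: 'b topology) act. is_minimal_flow (Homeo_top X) Y act \<longrightarrow>
            flow_maps_onto (Homeo_top X) (prod_LO_top X) (LO_act X) Y act)"
proof (intro conjI allI impI)
  show min: "is_minimal_flow (Homeo_top X) (prod_LO_top X) (LO_act X)"
    by (rule is_minimal_flow_prod_LO[OF assms])
  fix Y :: "'b topology" and act
  assume Y: "is_minimal_flow (Homeo_top X) Y act"
  show "flow_maps_onto (Homeo_top X) (prod_LO_top X) (LO_act X) Y act"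
  proof (cases "topspace X = {}")
    case True
    \<comment> \<open>Here the generating family of \<open>Homeo_top X\<close> is empty, so its carrier is empty instead of \<open>{id}\<close>.\<close>
    then have TG: "topspace (Homeo_top X) = {}" by (simp add: Homeo_top_def)
    obtain R where "R \<in> topspace (prod_LO_top X)" by (rule flow_point[OF is_flow_prod_LO[OF assms(1)]])
    then have P: "(\<lambda>_. c) ` topspace (prod_LO_top X) = {c}" for c :: 'b by blast
    have "is_flow (Homeo_top X) Y act" using Y by (simp add: is_minimal_flow_def)
    then obtain y where y: "y \<in> topspace Y" by (rule flow_point)
    \<comment> \<open>With no group elements every nonempty closed set is invariant, so minimality
      shrinks \<open>Y\<close> to a point and a constant map suffices.\<close>
    have "closedin Y {y}"
      using Y y by (intro closedin_Hausdorff_singleton) (simp_all add: is_minimal_flow_def is_flow_def)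
    moreover have "\<forall>Z. closedin Y Z \<and> Z \<noteq> {} \<longrightarrow> Z = topspace Y"
      using Y TG by (simp add: is_minimal_flow_def)
    ultimately have Yy: "topspace Y = {y}" by blast
    then show ?thesis
      unfolding flow_maps_onto_def TG by (intro exI[of _ "\<lambda>_. y"]) (simp add: P)
  next
    case False
    then show ?thesis by (rule flow_maps_onto_prod_LO[OF assms _ Y])
  qed
qed

end
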